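(* Let $G$ be a connected claw-free graph on $n\geq 24$ vertices, and let $\overline{G}$ denote its complement. If $\mu(\overline{G})\leq\mu(\overline{N_{n-3,3}})$, then $G$ is traceable unless $G=N_{n-3,3}$.
   Context: All graphs are finite, simple and undirected. $\overline{H}$ denotes the complement of a graph $H$. The spectral radius $\mu(H)$ of a graph $H$ is the spectral radius of its adjacency matrix, i.e. the maximum of the absolute values of the eigenvalues of the adjacency matrix (equivalently, its largest eigenvalue). A graph is claw-free if it contains no induced subgraph isomorphic to the claw $K_{1,3}$. A graph is traceable if it has a Hamilton path, i.e. a path containing all of its vertices. $N_{n-3,3}$ denotes the graph on $n$ vertices consisting of a complete graph $K_{n-3}$ together with three disjoint pendant edges: three distinct vertices $a_1,a_2,a_3$ of $K_{n-3}$ are chosen and three new vertices $b_1,b_2,b_3$ are added, with $b_i$ adjacent only to $a_i$ for $i=1,2,3$. Equality of graphs means isomorphism. *)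

theory Defs
  imports "Graph_Theory.Graph_Theory" "Jordan_Normal_Form.Spectral_Radius"
begin

text \<open>
  A finite simple undirected graph is a \<open>pair_graph\<close>: a finite vertex set with a symmetric,
  irreflexive arc relation, each edge \<open>uv\<close> being represented by the two arcs \<open>(u, v)\<close> and \<open>(v, u)\<close>.
\<close>

definition graph_complement :: "'a pair_pre_digraph \<Rightarrow> 'a pair_pre_digraph" where
  "graph_complement G =
     \<lparr> pverts = pverts G,
       parcs = {(u, v). u \<in> pverts G \<and> v \<in> pverts G \<and> u \<noteq> v \<and> (u, v) \<notin> parcs G} \<rparr>"

definition claw_free :: "'a pair_pre_digraph \<Rightarrow> bool" where
  "claw_free G \<longleftrightarrow>
     \<not> (\<exists>H. induced_subgraph H (with_proj G) \<and> complete_bipartite_digraph 1 3 H)"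

definition traceable :: "'a pair_pre_digraph \<Rightarrow> bool" where
  "traceable G \<longleftrightarrow> (\<exists>p. vpath p (with_proj G) \<and> set p = pverts G)"

definition adjacency_mat :: "'a pair_pre_digraph \<Rightarrow> 'a list \<Rightarrow> complex mat" where
  "adjacency_mat G vs =
     mat (length vs) (length vs) (\<lambda>(i, j). if (vs ! i, vs ! j) \<in> parcs G then 1 else 0)"

text \<open>
  The adjacency matrix depends on an enumeration of the vertices, but its spectral radius does
  not; see \<open>graph_spectral_radius_eq\<close> below.
\<close>

definition graph_spectral_radius :: "'a pair_pre_digraph \<Rightarrow> real" where
  "graph_spectral_radius G =
     spectral_radius (adjacency_mat G (SOME vs. distinct vs \<and> set vs = pverts G))"

text \<open>
  For \<open>k \<le> m\<close>: the complete graph on \<open>{0..<m}\<close> with \<open>k\<close> disjoint pendant edges, joining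
  the vertex \<open>i\<close> to the new vertex \<open>m + i\<close> for each \<open>i < k\<close>.
\<close>

definition N_graph :: "nat \<Rightarrow> nat \<Rightarrow> nat pair_pre_digraph" where
  "N_graph m k =
     \<lparr> pverts = {0..<m + k},
       parcs = {(i, j). i < m \<and> j < m \<and> i \<noteq> j}
             \<union> {(i, m + i) | i. i < k} \<union> {(m + i, i) | i. i < k} \<rparr>"

lemma pair_graph_complement:
  assumes "pair_graph G"
  shows "pair_graph (graph_complement G)"
proof -
  interpret pair_graph G by fact
  have "finite (parcs (graph_complement G))"
    by (rule finite_subset[of _ "pverts G \<times> pverts G"])
      (auto simp: graph_complement_def pair_finite_verts)
  moreover have "sym (parcs G)"
    using pair_sym_arcs by (simp add: symmetric_def)
  ultimately show ?thesis
    by unfold_locales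
      (auto simp: graph_complement_def symmetric_def pair_finite_verts intro!: symI dest: symD)
qed

lemma pair_graph_N_graph:
  assumes "k \<le> m"
  shows "pair_graph (N_graph m k)"
proof -
  have "finite (parcs (N_graph m k))"
    by (rule finite_subset[of _ "{0..<m + k} \<times> {0..<m + k}"])
      (use assms in \<open>auto simp: N_graph_def\<close>)
  then show ?thesis
    using assms by unfold_locales (auto simp: N_graph_def symmetric_def intro!: symI)
qed

lemma eigenvalue_adjacency_mat_reindex:
  assumes vs: "distinct vs" and ws: "distinct ws" and eq: "set vs = set ws"
    and ev: "eigenvalue (adjacency_mat G vs) c"
  shows "eigenvalue (adjacency_mat G ws) c"
proof -
  define n where "n = length vs"
  have lw: "length ws = n"
    using vs ws eq by (metis distinct_card n_def)
  have "\<forall>i<n. \<exists>j<n. vs ! j = ws ! i"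
    using eq lw by (metis in_set_conv_nth n_def)
  then obtain f where f: "\<And>i. i < n \<Longrightarrow> f i < n \<and> vs ! f i = ws ! i"
    by metis
  have inj: "inj_on f {..<n}"
    by (rule inj_onI) (metis f lessThan_iff lw nth_eq_iff_index_eq ws)
  have bij: "bij_betw f {..<n} {..<n}"
    using inj f by (simp add: bij_betw_def endo_inj_surj image_subset_iff)
  obtain x where x: "x \<in> carrier_vec n" "x \<noteq> 0\<^sub>v n" "adjacency_mat G vs *\<^sub>v x = c \<cdot>\<^sub>v x"
    using ev unfolding eigenvalue_def eigenvector_def by (auto simp: adjacency_mat_def n_def)
  define y where "y = vec n (\<lambda>i. x $ f i)"
  have row: "(\<Sum>j<n. (if (vs ! i, vs ! j) \<in> parcs G then 1 else 0) * x $ j) = c * x $ i"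
    if "i < n" for i
    using arg_cong[OF x(3), of "\<lambda>v. v $ i"] that x(1)
    by (auto simp: adjacency_mat_def n_def scalar_prod_def atLeast0LessThan)
  have "y \<noteq> 0\<^sub>v n"
  proof
    assume y0: "y = 0\<^sub>v n"
    have "x $ j = 0" if "j < n" for j
    proof -
      from that bij obtain i where "i < n" "j = f i"
        by (metis bij_betw_imp_surj_on imageE lessThan_iff)
      with y0 show ?thesis by (metis index_vec index_zero_vec(1) y_def)
    qed
    with x(1,2) show False by auto
  qed
  moreover have "adjacency_mat G ws *\<^sub>v y = c \<cdot>\<^sub>v y"
  proof (rule eq_vecI)
    fix i assume "i < dim_vec (c \<cdot>\<^sub>v y)"
    then have i: "i < n" by (simp add: y_def)
    have "(adjacency_mat G ws *\<^sub>v y) $ i =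
        (\<Sum>j<n. (if (ws ! i, ws ! j) \<in> parcs G then 1 else 0) * x $ f j)"
      using i lw by (auto simp: adjacency_mat_def y_def scalar_prod_def atLeast0LessThan)
    also have "\<dots> = (\<Sum>j<n. (if (vs ! f i, vs ! f j) \<in> parcs G then 1 else 0) * x $ f j)"
      using f i by (intro sum.cong) auto
    also have "\<dots> = (\<Sum>j<n. (if (vs ! f i, vs ! j) \<in> parcs G then 1 else 0) * x $ j)"
      by (rule sum.reindex_bij_betw[OF bij])
    also have "\<dots> = (c \<cdot>\<^sub>v y) $ i"
      using row[of "f i"] f[OF i] i by (simp only: y_def index_smult_vec dim_vec index_vec)
    finally show "(adjacency_mat G ws *\<^sub>v y) $ i = (c \<cdot>\<^sub>v y) $ i" .
  qed (simp add: adjacency_mat_def y_def lw)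
  ultimately show ?thesis
    unfolding eigenvalue_def eigenvector_def
    by (intro exI[of _ y]) (simp add: adjacency_mat_def lw y_def)
qed

lemma graph_spectral_radius_eq:
  assumes "distinct vs" "set vs = pverts G"
  shows "graph_spectral_radius G = spectral_radius (adjacency_mat G vs)"
proof -
  define ws where "ws = (SOME vs. distinct vs \<and> set vs = pverts G)"
  have "distinct ws \<and> set ws = pverts G"
    unfolding ws_def by (rule someI[of _ vs]) (use assms in blast)
  then have ws: "distinct ws" "set ws = set vs"
    using assms(2) by simp_all
  have "eigenvalue (adjacency_mat G ws) c \<longleftrightarrow> eigenvalue (adjacency_mat G vs) c" for c
    by (rule iffI; erule eigenvalue_adjacency_mat_reindex[rotated 3])
      (simp_all only: ws assms(1))
  then have "spectrum (adjacency_mat G ws) = spectrum (adjacency_mat G vs)"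
    by (simp add: spectrum_def set_eq_iff)
  then show ?thesis
    by (simp add: graph_spectral_radius_def spectral_radius_def ws_def)
qed

end

theory Submission
  imports Defs "HOL-Analysis.Convex"
begin

text \<open>
  Suppose \<open>G\<close> is not traceable and let \<open>R\<close> be an edge-maximal non-traceable supergraph of \<open>G\<close> on the same
  vertices. By Ore's crossing argument two vertices adjacent in the complement of \<open>R\<close> have degree sum
  at least \<open>n\<close> there, so the vertices of complement degree below \<open>n/2\<close> form a clique of \<open>R\<close>. The
  spectral radius of the complement of \<open>N\<^bsub>n-3,3\<^esub>\<close> is \<open>1 + sqrt (3n - 13)\<close>, and Rayleigh quotients then
  leave at most three other vertices. So \<open>R\<close> is a clique plus three vertices; connectedness and
  claw-freeness of \<open>G\<close> force these three to be pendant in \<open>G\<close> with distinct neighbours, that is,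
  \<open>G\<close> is a spanning subgraph of \<open>N\<^bsub>n-3,3\<^esub>\<close>. A missing edge would make the Rayleigh
  quotient of the (positive) Perron vector too large.
\<close>

section \<open>Rayleigh quotients and the spectral radius\<close>

text \<open>Adding edges can create claws, so the supergraph \<open>R\<close> need not be claw-free.
  Hence two relations run side by side: connectedness and claw-freeness are applied to the arcs
  \<open>E\<close> of the graph, while Ore's condition, the clique and the absence of Hamilton paths
  belong to \<open>R\<close>. The spectral hypothesis also concerns \<open>E\<close>, but the
  complement of \<open>R\<close> lies inside the complement of \<open>E\<close>, and for nonnegative
  vectors norm bounds and Rayleigh bounds pass to a smaller set of arcs. For this reason every test
  vector below is nonnegative.

  Four vertices of complement degree at least n-4 are spectrally no weaker than the complete
  bipartite graph with parts 4 and n-4, whose spectral radius 2 sqrt(n-4) exceeds 1 + sqrt(3n-13).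
  This comparison needs the number of such vertices to be exactly four, so larger numbers are
  excluded beforehand by counting degrees. The count is what makes n = 24 delicate: in
  \<open>heavy_le_half\<close> the same inequalities give no contradiction for n = 23.\<close>

definition nbr_sum :: "'a rel \<Rightarrow> ('a \<Rightarrow> real) \<Rightarrow> 'a \<Rightarrow> real" where
  "nbr_sum S x u = (\<Sum>v\<in>S `` {u}. x v)"

definition vec_of :: "'a list \<Rightarrow> ('a \<Rightarrow> real) \<Rightarrow> complex vec" where
  "vec_of vs x = vec (length vs) (\<lambda>i. complex_of_real (x (vs ! i)))"

lemma nbr_sum_if:
  assumes "finite V" "S \<subseteq> V \<times> V"
  shows "nbr_sum S x u = (\<Sum>v\<in>V. if (u, v) \<in> S then x v else 0)"
proof -
  have "S `` {u} = {v \<in> V. (u, v) \<in> S}"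
    using assms(2) by auto
  then show ?thesis
    using assms(1) by (simp add: nbr_sum_def sum.inter_filter)
qed

lemma nbr_sum_funpow_scale:
  "(nbr_sum S ^^ m) (\<lambda>v. c * x v) = (\<lambda>u. c * (nbr_sum S ^^ m) x u)"
  by (induction m) (auto simp: nbr_sum_def sum_distrib_left)

text \<open>Identifies \<open>nbr_sum\<close> with the adjacency operator, so that powers of the
  matrix become iterates on real functions of the vertices.\<close>

lemma adjacency_mat_mult_vec_of:
  assumes "distinct vs" "parcs H \<subseteq> set vs \<times> set vs"
  shows "adjacency_mat H vs *\<^sub>v vec_of vs x = vec_of vs (nbr_sum (parcs H) x)"
proof (rule eq_vecI)
  fix i assume "i < dim_vec (vec_of vs (nbr_sum (parcs H) x))"
  then have i: "i < length vs" by (simp add: vec_of_def)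
  have "(adjacency_mat H vs *\<^sub>v vec_of vs x) $ i =
      (\<Sum>j<length vs. (if (vs ! i, vs ! j) \<in> parcs H then 1 else 0) * complex_of_real (x (vs ! j)))"
    using i by (simp add: adjacency_mat_def vec_of_def scalar_prod_def atLeast0LessThan)
  also have "\<dots> = (\<Sum>v\<in>set vs. (if (vs ! i, v) \<in> parcs H then 1 else 0) * complex_of_real (x v))"
    by (rule sum.reindex_bij_betw[OF bij_betw_nth[OF assms(1) refl refl]])
  also have "\<dots> = complex_of_real (nbr_sum (parcs H) x (vs ! i))"
    by (subst nbr_sum_if[OF finite_set assms(2)], unfold of_real_sum, rule sum.cong) auto
  finally show "(adjacency_mat H vs *\<^sub>v vec_of vs x) $ i = vec_of vs (nbr_sum (parcs H) x) $ i"
    using i by (simp add: vec_of_def)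
qed (simp add: vec_of_def adjacency_mat_def)

lemma smult_mat_mult_vec:
  fixes M :: "'b :: comm_semiring_0 mat"
  assumes "w \<in> carrier_vec (dim_col M)"
  shows "(k \<cdot>\<^sub>m M) *\<^sub>v w = k \<cdot>\<^sub>v (M *\<^sub>v w)"
  using assms by (intro eq_vecI) (auto simp: scalar_prod_def sum_distrib_left mult.assoc)

text \<open>Dividing the adjacency matrix by \<open>r\<close> brings its spectral radius below 1,
  and the powers of such a matrix have uniformly bounded entries. Scaling back produces the factor
  \<open>r ^ m\<close>.\<close>

lemma nbr_sum_funpow_bounded:
  assumes fin: "finite V" and ne: "V \<noteq> {}" and arcs: "parcs H \<subseteq> V \<times> V" and V: "pverts H = V"
    and r: "graph_spectral_radius H < r" "r > 0"
  obtains c where "\<And>m u. u \<in> V \<Longrightarrow> \<bar>(nbr_sum (parcs H) ^^ m) x u\<bar> \<le> c * r ^ m"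
proof -
  obtain vs where vs: "distinct vs" "set vs = V"
    using finite_distinct_list[OF fin] by blast
  define n where "n = length vs"
  have n: "n > 0" using vs ne by (auto simp: n_def)
  define A where "A = adjacency_mat H vs"
  define B where "B = complex_of_real (1 / r) \<cdot>\<^sub>m A"
  have A: "A \<in> carrier_mat n n" and B: "B \<in> carrier_mat n n"
    by (simp_all add: A_def B_def adjacency_mat_def n_def)
  have srA: "spectral_radius A < r"
    using r(1) graph_spectral_radius_eq[of vs H] vs V by (simp add: A_def)
  \<comment> \<open>An eigenvector of \<open>B\<close> for \<open>e\<close> is an eigenvector of
    \<open>A\<close> for \<open>r * e\<close>.\<close>
  have "spectral_radius B < 1"
  proof -
    obtain e where e: "e \<in> spectrum B" "spectral_radius B = norm e"
      using spectral_radius_mem_max(1)[OF B n] by auto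
    then obtain w where w: "w \<in> carrier_vec n" "w \<noteq> 0\<^sub>v n" "B *\<^sub>v w = e \<cdot>\<^sub>v w"
      using B unfolding spectrum_def eigenvalue_def eigenvector_def by auto
    have "A = complex_of_real r \<cdot>\<^sub>m B"
      using r(2) A by (intro eq_matI) (auto simp: B_def)
    then have "A *\<^sub>v w = complex_of_real r \<cdot>\<^sub>v (B *\<^sub>v w)"
      using smult_mat_mult_vec[of w B] B w(1) by simp
    also have "\<dots> = (complex_of_real r * e) \<cdot>\<^sub>v w"
      unfolding w(3) by (simp add: smult_smult_assoc)
    finally have "complex_of_real r * e \<in> spectrum A"
      using w A unfolding spectrum_def eigenvalue_def eigenvector_def by auto
    then have "r * norm e \<le> spectral_radius A"
      using spectral_radius_mem_max(2)[OF A n imageI, of "complex_of_real r * e"] r(2)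
      by (simp add: norm_mult)
    with srA r(2) e(2) show ?thesis
      by (metis linorder_not_le mult_less_cancel_left2 order_le_less_trans order_less_asym)
  qed
  then obtain c where c: "\<And>k. norm_bound (B ^\<^sub>m k) c"
    using spectral_radius_jnf_norm_bound_less_1_upper_triangular[OF B] by blast
  have step: "B *\<^sub>v vec_of vs y = vec_of vs (\<lambda>v. (1 / r) * nbr_sum (parcs H) y v)" for y
  proof -
    have "vec_of vs y \<in> carrier_vec n" by (simp add: vec_of_def n_def)
    then have "B *\<^sub>v vec_of vs y = complex_of_real (1 / r) \<cdot>\<^sub>v (A *\<^sub>v vec_of vs y)"
      unfolding B_def using A by (intro smult_mat_mult_vec) auto
    also have "A *\<^sub>v vec_of vs y = vec_of vs (nbr_sum (parcs H) y)"
      unfolding A_def using vs arcs by (intro adjacency_mat_mult_vec_of) auto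
    finally show ?thesis
      by (auto simp: vec_of_def)
  qed
  have pow: "B ^\<^sub>m k *\<^sub>v vec_of vs y = vec_of vs (\<lambda>v. (1 / r) ^ k * (nbr_sum (parcs H) ^^ k) y v)" for k y
  proof (induction k arbitrary: y)
    case 0
    then show ?case by (simp add: vec_of_def B_def A_def adjacency_mat_def)
  next
    case (Suc k)
    have "vec_of vs y \<in> carrier_vec n" by (simp add: vec_of_def n_def)
    then have "B ^\<^sub>m Suc k *\<^sub>v vec_of vs y = B ^\<^sub>m k *\<^sub>v (B *\<^sub>v vec_of vs y)"
      using B by (simp add: assoc_mult_mat_vec[of _ n n _ n])
    also have "\<dots> = vec_of vs (\<lambda>v. (1 / r) ^ k * ((1 / r) * (nbr_sum (parcs H) ^^ k) (nbr_sum (parcs H) y) v))"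
      unfolding step Suc.IH nbr_sum_funpow_scale ..
    finally show ?case by (simp add: funpow_Suc_right mult_ac del: funpow.simps)
  qed
  have "\<bar>(nbr_sum (parcs H) ^^ m) x u\<bar> \<le> (c * (\<Sum>j<n. \<bar>x (vs ! j)\<bar>)) * r ^ m" if u: "u \<in> V" for m u
  proof -
    obtain i where i: "i < n" "vs ! i = u"
      using u vs by (metis in_set_conv_nth n_def)
    have "complex_of_real ((1 / r) ^ m * (nbr_sum (parcs H) ^^ m) x u) = (B ^\<^sub>m m *\<^sub>v vec_of vs x) $ i"
      using i by (simp add: pow) (simp add: vec_of_def n_def)
    also have "\<dots> = (\<Sum>j<n. (B ^\<^sub>m m) $$ (i, j) * complex_of_real (x (vs ! j)))"
      using i B by (simp add: scalar_prod_def vec_of_def n_def atLeast0LessThan)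
    finally have "norm (complex_of_real ((1 / r) ^ m * (nbr_sum (parcs H) ^^ m) x u))
        \<le> (\<Sum>j<n. norm ((B ^\<^sub>m m) $$ (i, j)) * \<bar>x (vs ! j)\<bar>)"
      by (auto intro!: order_trans[OF norm_sum] sum_mono simp: norm_mult)
    also have "\<dots> \<le> (\<Sum>j<n. c * \<bar>x (vs ! j)\<bar>)"
      using c[of m] i B by (intro sum_mono mult_right_mono) (auto simp: norm_bound_def)
    finally have "(1 / r) ^ m * \<bar>(nbr_sum (parcs H) ^^ m) x u\<bar> \<le> c * (\<Sum>j<n. \<bar>x (vs ! j)\<bar>)"
      using r(2) by (simp add: norm_mult norm_power norm_divide abs_mult sum_distrib_left)
    then show ?thesis
      using r(2) by (simp add: field_simps power_divide)
  qed
  then show ?thesis using that by blast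
qed

lemma nbr_sum_self_adjoint:
  assumes "finite V" "S \<subseteq> V \<times> V" "sym S"
  shows "(\<Sum>u\<in>V. x u * nbr_sum S y u) = (\<Sum>u\<in>V. nbr_sum S x u * y u)"
proof -
  have "(\<Sum>u\<in>V. x u * nbr_sum S y u) = (\<Sum>u\<in>V. \<Sum>v\<in>V. if (u, v) \<in> S then x u * y v else 0)"
    by (auto simp: nbr_sum_if[OF assms(1,2)] sum_distrib_left intro!: sum.cong)
  also have "\<dots> = (\<Sum>v\<in>V. \<Sum>u\<in>V. if (u, v) \<in> S then x u * y v else 0)"
    by (rule sum.swap)
  also have "\<dots> = (\<Sum>u\<in>V. nbr_sum S x u * y u)"
    using assms(3) by (auto simp: nbr_sum_if[OF assms(1,2)] sum_distrib_right sym_def intro!: sum.cong)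
  finally show ?thesis .
qed

text \<open>For a symmetric matrix the squared norms of the iterates of a vector are log-convex, so the growth in
  the first step persists; powers of the matrix, however, grow no faster than the spectral radius allows.\<close>

lemma spectral_radius_ge_nbr_sum_norm:
  assumes G: "pair_graph H" and ne: "pverts H \<noteq> {}"
  shows "(\<Sum>u\<in>pverts H. (nbr_sum (parcs H) x u)\<^sup>2) \<le> (graph_spectral_radius H)\<^sup>2 * (\<Sum>u\<in>pverts H. (x u)\<^sup>2)"
    and "graph_spectral_radius H \<ge> 0"
proof -
  interpret pair_graph H by fact
  define V where "V = pverts H"
  define \<mu> where "\<mu> = graph_spectral_radius H"
  have fin: "finite V" and arcs: "parcs H \<subseteq> V \<times> V" and sym: "sym (parcs H)"
    using pair_finite_verts in_arcsD1 in_arcsD2 arcs_symmetric by (auto simp: V_def sym_def)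
  obtain vs where vs: "distinct vs" "set vs = V"
    using finite_distinct_list[OF fin] by blast
  have "adjacency_mat H vs \<in> carrier_mat (length vs) (length vs)" "length vs > 0"
    using vs ne by (auto simp: adjacency_mat_def V_def)
  from spectral_radius_mem_max(1)[OF this] show \<mu>: "graph_spectral_radius H \<ge> 0"
    using graph_spectral_radius_eq[of vs H] vs by (auto simp: V_def)
  show "(\<Sum>u\<in>pverts H. (nbr_sum (parcs H) x u)\<^sup>2) \<le> (graph_spectral_radius H)\<^sup>2 * (\<Sum>u\<in>pverts H. (x u)\<^sup>2)"
  proof (rule ccontr)
    define X where "X m = (nbr_sum (parcs H) ^^ m) x" for m
    define s where "s m = (\<Sum>u\<in>V. (X m u)\<^sup>2)" for m
    assume "\<not> ?thesis"
    then have less: "\<mu>\<^sup>2 * s 0 < s 1"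
      by (simp add: s_def X_def \<mu>_def V_def)
    have s_nonneg: "s m \<ge> 0" for m by (simp add: s_def sum_nonneg)
    \<comment> \<open>If \<open>x\<close> vanished on \<open>V\<close>, so would its image, and
      \<open>less\<close> would read 0 < 0.\<close>
    have s0: "s 0 > 0"
    proof (rule ccontr)
      assume "\<not> s 0 > 0"
      with s_nonneg[of 0] have "s 0 = 0" by simp
      then have "X 0 u = 0" if "u \<in> V" for u
        using that fin by (simp add: s_def sum_nonneg_eq_0_iff)
      then have "nbr_sum (parcs H) (X 0) u = 0" for u
        using arcs unfolding nbr_sum_def by (intro sum.neutral) auto
      then have "s 1 = 0" by (simp add: s_def X_def)
      with less \<open>s 0 = 0\<close> show False by simp
    qed
    \<comment> \<open>\<open>q\<close> is the growth factor of the first step. For any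
      \<open>r\<close> strictly between \<mu> and \<open>sqrt q\<close>, the squared norms are at
      most of order \<open>(r\<^sup>2) ^ m\<close> but at least \<open>q ^ m * s 0\<close>.\<close>
    define q where "q = s 1 / s 0"
    have "\<mu>\<^sup>2 < q" using less s0 by (simp add: q_def field_simps)
    then have "\<mu> < sqrt q" by (simp add: real_less_rsqrt)
    then obtain r where r: "\<mu> < r" "r < sqrt q" using dense by blast
    have r0: "r > 0" using r(1) \<mu> by (simp add: \<mu>_def)
    have rq: "r\<^sup>2 < q" using r r0 by (metis less_eq_real_def real_less_lsqrt real_sqrt_less_iff real_sqrt_abs abs_of_pos)
    \<comment> \<open>Self-adjointness turns the squared norm of iterate m+1 into the inner product
      of iterates m and m+2; Cauchy-Schwarz bounds that product.\<close>
    have logconvex: "(s (Suc m))\<^sup>2 \<le> s m * s (Suc (Suc m))" for m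
    proof -
      have "s (Suc m) = (\<Sum>u\<in>V. X (Suc m) u * nbr_sum (parcs H) (X m) u)"
        by (simp add: s_def X_def power2_eq_square)
      also have "\<dots> = (\<Sum>u\<in>V. X (Suc (Suc m)) u * X m u)"
        by (subst nbr_sum_self_adjoint[OF fin arcs sym]) (simp add: X_def)
      finally show ?thesis
        using Cauchy_Schwarz_ineq_sum[of "X (Suc (Suc m))" "X m" V] by (simp add: s_def mult.commute)
    qed
    have growth: "s m > 0 \<and> s (Suc m) \<ge> q * s m" for m
    proof (induction m)
      case 0
      then show ?case using s0 by (simp add: q_def)
    next
      case (Suc m)
      have "q > 0" using rq r0 by (smt (verit) zero_le_power2)
      then have pos: "s (Suc m) > 0" using Suc by (smt (verit) mult_pos_pos)
      have "q * s m * s (Suc m) \<le> s (Suc m) * s (Suc m)"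
        using Suc pos by (intro mult_right_mono) auto
      also have "\<dots> \<le> s m * s (Suc (Suc m))"
        using logconvex[of m] by (simp add: power2_eq_square)
      finally have "q * s (Suc m) \<le> s (Suc (Suc m))"
        using Suc by (simp add: mult.assoc mult.left_commute)
      with pos show ?case by simp
    qed
    have lower: "s m \<ge> q ^ m * s 0" for m
    proof (induction m)
      case (Suc m)
      have "q \<ge> 0" using rq by (smt (verit) zero_le_power2)
      then have "q * (q ^ m * s 0) \<le> q * s m" using Suc by (rule mult_left_mono[rotated])
      then show ?case using growth[of m] by simp
    qed simp
    obtain c where c: "\<And>m u. u \<in> V \<Longrightarrow> \<bar>X m u\<bar> \<le> c * r ^ m"
      using nbr_sum_funpow_bounded[OF fin _ arcs V_def[symmetric], of r x] r(1) r0 ne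
      unfolding X_def V_def \<mu>_def by metis
    have upper: "s m \<le> (card V * c\<^sup>2) * (r\<^sup>2) ^ m" for m
    proof -
      have "(X m u)\<^sup>2 \<le> c\<^sup>2 * (r\<^sup>2) ^ m" if "u \<in> V" for u
        using power_mono[OF c[OF that, of m], of 2]
        by (simp add: power_mult_distrib flip: power_mult) (simp add: mult.commute)
      then have "s m \<le> (\<Sum>u\<in>V. c\<^sup>2 * (r\<^sup>2) ^ m)"
        unfolding s_def by (rule sum_mono)
      then show ?thesis by simp
    qed
    have "(q / r\<^sup>2) ^ m \<le> card V * c\<^sup>2 / s 0" for m
      using order_trans[OF lower upper, of m] s0 r0 by (simp add: field_simps power_divide)
    moreover have "q / r\<^sup>2 > 1" using rq r0 by simp
    ultimately show False
      using real_arch_pow by (metis linorder_not_le)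
  qed
qed

text \<open>Cauchy-Schwarz between \<open>x\<close> and its image reduces this to the norm
  bound.\<close>

lemma spectral_radius_ge_rayleigh:
  assumes G: "pair_graph H" and ne: "pverts H \<noteq> {}"
  shows "(\<Sum>u\<in>pverts H. x u * nbr_sum (parcs H) x u) \<le> graph_spectral_radius H * (\<Sum>u\<in>pverts H. (x u)\<^sup>2)"
proof -
  let ?\<mu> = "graph_spectral_radius H" and ?s = "\<Sum>u\<in>pverts H. (x u)\<^sup>2"
  have "(\<Sum>u\<in>pverts H. x u * nbr_sum (parcs H) x u)\<^sup>2 \<le> ?s * (\<Sum>u\<in>pverts H. (nbr_sum (parcs H) x u)\<^sup>2)"
    by (rule Cauchy_Schwarz_ineq_sum)
  also have "\<dots> \<le> ?s * (?\<mu>\<^sup>2 * ?s)"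
    by (intro mult_left_mono spectral_radius_ge_nbr_sum_norm assms sum_nonneg) simp
  also have "\<dots> = (?\<mu> * ?s)\<^sup>2"
    by (simp add: power2_eq_square)
  finally show ?thesis
    by (rule power2_le_imp_le) (simp add: sum_nonneg spectral_radius_ge_nbr_sum_norm(2)[OF assms])
qed

text \<open>Let \<open>y\<close> consist of the moduli of the entries of an eigenvector whose
  eigenvalue \<open>e\<close> has maximal modulus. The triangle inequality gives |e| y \<le> A y
  entrywise. Pairing with \<open>x\<close> and moving A across yields |e| <x, y> \<le> c <x, y>,
  where <x, y> is positive because \<open>x\<close> is positive and \<open>y\<close> is nonnegative
  and nonzero.\<close>

lemma spectral_radius_le_positive_vector:
  assumes G: "pair_graph H" and ne: "pverts H \<noteq> {}"
    and pos: "\<And>u. u \<in> pverts H \<Longrightarrow> x u > 0"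
    and le: "\<And>u. u \<in> pverts H \<Longrightarrow> nbr_sum (parcs H) x u \<le> c * x u"
  shows "graph_spectral_radius H \<le> c"
proof -
  interpret pair_graph H by fact
  define V where "V = pverts H"
  have fin: "finite V" and arcs: "parcs H \<subseteq> V \<times> V" and sym: "sym (parcs H)"
    using pair_finite_verts in_arcsD1 in_arcsD2 arcs_symmetric by (auto simp: V_def sym_def)
  obtain vs where vs: "distinct vs" "set vs = V"
    using finite_distinct_list[OF fin] by blast
  define n where "n = length vs"
  have A: "adjacency_mat H vs \<in> carrier_mat n n" "n > 0"
    using vs ne by (auto simp: adjacency_mat_def V_def n_def)
  obtain e where e: "e \<in> spectrum (adjacency_mat H vs)" "graph_spectral_radius H = norm e"
    using spectral_radius_mem_max(1)[OF A] graph_spectral_radius_eq[of vs H] vs by (auto simp: V_def)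
  then obtain w where w: "w \<in> carrier_vec n" "w \<noteq> 0\<^sub>v n" "adjacency_mat H vs *\<^sub>v w = e \<cdot>\<^sub>v w"
    using A unfolding spectrum_def eigenvalue_def eigenvector_def by auto
  have bij: "bij_betw ((!) vs) {..<n} V"
    using bij_betw_nth[OF vs(1) refl refl] vs(2) by (simp add: n_def)
  define y where "y v = norm (w $ (the_inv_into {..<n} ((!) vs) v))" for v
  have y: "y (vs ! i) = norm (w $ i)" if "i < n" for i
    using that bij by (simp add: y_def the_inv_into_f_f bij_betw_imp_inj_on)
  have ev: "norm e * y u \<le> nbr_sum (parcs H) y u" if u: "u \<in> V" for u
  proof -
    obtain i where i: "i < n" "vs ! i = u"
      using u vs by (metis in_set_conv_nth n_def)
    have "(adjacency_mat H vs *\<^sub>v w) $ i = (\<Sum>j<n. (if (u, vs ! j) \<in> parcs H then 1 else 0) * w $ j)"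
      using i(1) w(1) unfolding i(2)[symmetric]
      by (simp add: adjacency_mat_def n_def scalar_prod_def atLeast0LessThan)
    then have "norm (e * w $ i) = norm (\<Sum>j<n. (if (u, vs ! j) \<in> parcs H then 1 else 0) * w $ j)"
      using i(1) w(1) by (simp add: w(3))
    also have "\<dots> \<le> (\<Sum>j<n. norm ((if (u, vs ! j) \<in> parcs H then 1 else 0) * w $ j))"
      by (rule norm_sum)
    finally have "norm e * norm (w $ i) \<le> (\<Sum>j<n. norm ((if (u, vs ! j) \<in> parcs H then 1 else 0) * w $ j))"
      by (simp only: norm_mult)
    also have "\<dots> = (\<Sum>j<n. if (u, vs ! j) \<in> parcs H then norm (w $ j) else 0)"
      by (rule sum.cong) simp_all
    also have "\<dots> = (\<Sum>j<n. if (u, vs ! j) \<in> parcs H then y (vs ! j) else 0)"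
      using y by (intro sum.cong) auto
    also have "\<dots> = (\<Sum>v\<in>V. if (u, v) \<in> parcs H then y v else 0)"
      by (rule sum.reindex_bij_betw[OF bij])
    finally show ?thesis
      using y[OF i(1)] unfolding i(2) by (simp add: nbr_sum_if[OF fin arcs])
  qed
  have y_nonneg: "y u \<ge> 0" for u by (simp add: y_def)
  obtain i where i: "i < n" "w $ i \<noteq> 0"
    using w(1,2) by (metis carrier_vecD eq_vecI index_zero_vec(1) index_zero_vec(2))
  then have "y (vs ! i) > 0" "vs ! i \<in> V"
    using y vs by (auto simp: n_def)
  then have sum_pos: "(\<Sum>u\<in>V. x u * y u) > 0"
    using pos y_nonneg fin by (intro sum_pos2[of _ "vs ! i"]) (auto simp: V_def less_imp_le)
  have "norm e * (\<Sum>u\<in>V. x u * y u) = (\<Sum>u\<in>V. x u * (norm e * y u))"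
    by (simp add: sum_distrib_left mult_ac)
  also have "\<dots> \<le> (\<Sum>u\<in>V. x u * nbr_sum (parcs H) y u)"
    using ev pos by (intro sum_mono mult_left_mono) (auto simp: V_def less_imp_le)
  also have "\<dots> = (\<Sum>u\<in>V. nbr_sum (parcs H) x u * y u)"
    by (rule nbr_sum_self_adjoint[OF fin arcs sym])
  also have "\<dots> \<le> (\<Sum>u\<in>V. c * x u * y u)"
    using le y_nonneg by (intro sum_mono mult_right_mono) (auto simp: V_def)
  also have "\<dots> = c * (\<Sum>u\<in>V. x u * y u)"
    by (simp add: sum_distrib_left mult_ac)
  finally show ?thesis
    using sum_pos e(2) by simp
qed

section \<open>Hamilton paths in a clique plus three vertices\<close>

definition has_hamilton_path :: "'a set \<Rightarrow> 'a rel \<Rightarrow> bool" where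
  "has_hamilton_path V R \<longleftrightarrow> (\<exists>p. distinct p \<and> set p = V \<and> successively (\<lambda>u v. (u, v) \<in> R) p)"

lemma successively_clique:
  assumes "set p \<subseteq> C" "distinct p" "\<And>u v. u \<in> C \<Longrightarrow> v \<in> C \<Longrightarrow> u \<noteq> v \<Longrightarrow> (u, v) \<in> R"
  shows "successively (\<lambda>u v. (u, v) \<in> R) p"
proof -
  have "sorted_wrt (\<lambda>u v. (u, v) \<in> R) p"
    using assms by (intro sorted_wrt_iff_nth_less[THEN iffD2] allI impI) (simp add: nth_eq_iff_index_eq subset_iff)
  then show ?thesis
    by (rule successively_if_sorted_wrt)
qed

text \<open>\<open>E\<close> carries the local structure of the original graph, \<open>R\<close> is
  its saturation; a path may use any arc of \<open>R\<close>, a claw must be built in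
  \<open>E\<close>. Four clique vertices guarantee one outside any three given vertices.\<close>

locale clique_plus_three =
  fixes V :: "'a set" and E R :: "'a rel" and C :: "'a set"
  assumes finC: "finite C" and cardC: "card C \<ge> 4"
    and symR: "sym R" and symE: "sym E" and ER: "E \<subseteq> R" and EV: "E \<subseteq> V \<times> V" and irrE: "irrefl E"
    and clique: "u \<in> C \<Longrightarrow> v \<in> C \<Longrightarrow> u \<noteq> v \<Longrightarrow> (u, v) \<in> R"
    and conn: "S \<subset> V \<Longrightarrow> S \<noteq> {} \<Longrightarrow> \<exists>u\<in>S. \<exists>v\<in>V - S. (u, v) \<in> E"
    and claw: "(u, x) \<in> E \<Longrightarrow> (u, y) \<in> E \<Longrightarrow> (u, z) \<in> E \<Longrightarrow> distinct [x, y, z] \<Longrightarrow>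
      (x, y) \<in> E \<or> (x, z) \<in> E \<or> (y, z) \<in> E"
    and nonham: "\<not> has_hamilton_path V R"
begin

text \<open>The three exceptional vertices are named in order, so that symmetric cases are obtained
  by permuting the arguments.\<close>

definition split_off :: "'a \<Rightarrow> 'a \<Rightarrow> 'a \<Rightarrow> bool" where
  "split_off b1 b2 b3 \<longleftrightarrow> distinct [b1, b2, b3] \<and> V = {b1, b2, b3} \<union> C \<and> {b1, b2, b3} \<inter> C = {}"

lemma split_off_perm:
  assumes "split_off b1 b2 b3"
  shows "split_off b2 b1 b3" "split_off b1 b3 b2"
proof -
  have "{b2, b1, b3} = {b1, b2, b3}" "{b1, b3, b2} = {b1, b2, b3}"
    by blast+
  then show "split_off b2 b1 b3" "split_off b1 b3 b2"
    using assms unfolding split_off_def by auto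
qed

text \<open>All Hamilton paths of this section arise here: the clique vertices missing from
  \<open>xs\<close> and \<open>ys\<close> can be inserted between them in any order, so it suffices
  that the two paths cover everything outside \<open>C\<close> and face each other with clique
  vertices.\<close>

lemma no_two_ended_path:
  assumes "xs \<noteq> []" "ys \<noteq> []" "last xs \<in> C" "hd ys \<in> C" "distinct (xs @ ys)"
    and "successively (\<lambda>u v. (u, v) \<in> R) xs" "successively (\<lambda>u v. (u, v) \<in> R) ys"
    and "V - C \<subseteq> set xs \<union> set ys" "set xs \<union> set ys \<subseteq> V" "C \<subseteq> V"
  shows False
proof -
  obtain zs where zs: "set zs = C - set xs - set ys" "distinct zs"
    using finC finite_distinct_list[of "C - set xs - set ys"] by blast
  have ends: "last xs \<in> set xs" "hd ys \<in> set ys"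
    using assms(1,2) by auto
  then have "last xs \<noteq> hd ys"
    using assms(5) by (metis disjoint_iff distinct_append)
  have "successively (\<lambda>u v. (u, v) \<in> R) (last xs # zs @ [hd ys])"
  proof (rule successively_clique[OF _ _ clique])
    show "distinct (last xs # zs @ [hd ys])"
      using zs ends \<open>last xs \<noteq> hd ys\<close> by auto
  qed (use zs assms in auto)
  then have mid: "(last xs, hd (zs @ ys)) \<in> R" "successively (\<lambda>u v. (u, v) \<in> R) (zs @ ys)"
    using assms(2,7) by (auto simp: successively_append_iff successively_Cons hd_append split: if_splits)
  then have "successively (\<lambda>u v. (u, v) \<in> R) (xs @ zs @ ys)"
    using assms(1,6) by (auto simp: successively_append_iff)
  moreover have "distinct (xs @ zs @ ys)" "set (xs @ zs @ ys) = V"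
    using zs assms by auto
  ultimately have "has_hamilton_path V R"
    unfolding has_hamilton_path_def by blast
  with nonham show False ..
qed

lemma R_sym: "(u, v) \<in> R \<Longrightarrow> (v, u) \<in> R"
  by (rule symD[OF symR])

lemma E_sym: "(u, v) \<in> E \<Longrightarrow> (v, u) \<in> E"
  by (rule symD[OF symE])

lemma E_R: "(u, v) \<in> E \<Longrightarrow> (u, v) \<in> R"
  using ER by blast

lemma E_neq: "(u, v) \<in> E \<Longrightarrow> u \<noteq> v"
  using irrE by (auto simp: irrefl_def)

lemma R_commute: "(u, v) \<in> R \<longleftrightarrow> (v, u) \<in> R"
  by (rule iffI; erule R_sym)

lemma cut_edge:
  assumes "S \<subseteq> V" "S \<noteq> {}" "c \<in> V - S"
  obtains u v where "u \<in> S" "v \<in> V - S" "(u, v) \<in> E"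
proof -
  have "S \<subset> V" using assms by blast
  from conn[OF this assms(2)] show ?thesis using that by blast
qed

lemma fresh_in_C:
  assumes "card S \<le> 3" "finite S"
  obtains c where "c \<in> C" "c \<notin> S"
proof -
  have "\<not> C \<subseteq> S"
    using card_mono[of S C] assms cardC by auto
  then show ?thesis using that by blast
qed

text \<open>An end of a path through the three vertices has no \<open>R\<close>-neighbour in
  \<open>C\<close>, since the path would continue through the clique. So \<open>C\<close> is
  attached through \<open>b2\<close> alone, \<open>b1\<close> and \<open>b3\<close> hang on
  \<open>b2\<close>, and together with a clique neighbour they form a claw centred at
  \<open>b2\<close>.\<close>

lemma no_spanning_path_of_B:
  assumes sp: "split_off b1 b2 b3" and "(b1, b2) \<in> R" "(b2, b3) \<in> R"
  shows False
proof -
  have end3: False if sp: "split_off x y z" and R: "(x, y) \<in> R" "(y, z) \<in> R" "(z, c) \<in> R" and c: "c \<in> C" for x y z c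
  proof -
    obtain c' where c': "c' \<in> C" "c' \<notin> {c}"
      by (rule fresh_in_C[of "{c}"]) auto
    show False
      by (rule no_two_ended_path[of "[x, y, z, c]" "[c']"]) (use sp R c c' in \<open>auto simp: split_off_def\<close>)
  qed
  have no1: "(b1, c) \<notin> R" if "c \<in> C" for c
    using end3[of b3 b2 b1 c] assms that R_commute by (auto simp: split_off_def)
  have no3: "(b3, c) \<notin> R" if "c \<in> C" for c
    using end3[of b1 b2 b3 c] assms that R_commute by (auto simp: split_off_def)
  have V: "V = {b1, b2, b3} \<union> C" "distinct [b1, b2, b3]" "{b1, b2, b3} \<inter> C = {}"
    using sp by (auto simp: split_off_def)
  obtain c0 where c0: "c0 \<in> C" by (rule fresh_in_C[of "{}"]) auto
  obtain u c where "u \<in> {b1, b2, b3}" "c \<in> C" "(u, c) \<in> E"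
    by (rule cut_edge[of "{b1, b2, b3}" c0]) (use V c0 in auto)
  then have c: "c \<in> C" "(b2, c) \<in> E"
    using no1 no3 E_R by auto
  have b13: "(b1, b3) \<notin> R"
    using end3[of b1 b3 b2 c] assms c E_R R_commute by (auto simp: split_off_def)
  obtain v1 where "v1 \<in> V - {b1}" "(b1, v1) \<in> E"
    by (rule cut_edge[of "{b1}" b2]) (use V in auto)
  then have E1: "(b2, b1) \<in> E"
    using V no1 b13 E_R E_sym by auto
  obtain v3 where "v3 \<in> V - {b3}" "(b3, v3) \<in> E"
    by (rule cut_edge[of "{b3}" b2]) (use V in auto)
  then have E3: "(b2, b3) \<in> E"
    using V no3 b13 E_R E_sym R_sym by auto
  have "distinct [b1, b3, c]" using V c by auto
  from claw[OF E1 E3 c(2) this] show False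
    using no1 no3 c b13 E_R by blast
qed

text \<open>The piece {b1, b2} and the vertex \<open>b3\<close> must attach to the clique at the
  same vertex \<open>c\<close>; two different attachments would be joined through the clique. Then
  \<open>c\<close> separates the rest of the clique, and \<open>b2\<close>, \<open>b3\<close> and an
  \<open>E\<close>-neighbour of \<open>c\<close> in that rest form a claw.\<close>

lemma no_edge_in_B_aux:
  assumes sp: "split_off b1 b2 b3" and R12: "(b1, b2) \<in> R" and nR: "(b1, b3) \<notin> R" "(b2, b3) \<notin> R"
    and c: "c \<in> C" "(b2, c) \<in> E"
  shows False
proof -
  have V: "V = {b1, b2, b3} \<union> C" "distinct [b1, b2, b3]" "{b1, b2, b3} \<inter> C = {}"
    using sp by (auto simp: split_off_def)
  have path: "y = z" if "y \<in> C" "z \<in> C" "(b1, y) \<in> R \<or> (b2, y) \<in> R" "(b3, z) \<in> R" for y z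
  proof (rule ccontr)
    assume "y \<noteq> z"
    show False
    proof (cases "(b2, y) \<in> R")
      case True
      show False
        by (rule no_two_ended_path[of "[b1, b2, y]" "[z, b3]"]) (use True V that \<open>y \<noteq> z\<close> R12 R_commute in auto)
    next
      case False
      show False
        by (rule no_two_ended_path[of "[b2, b1, y]" "[z, b3]"]) (use False V that \<open>y \<noteq> z\<close> R12 R_commute in auto)
    qed
  qed
  obtain v3 where "v3 \<in> V - {b3}" "(b3, v3) \<in> E"
    by (rule cut_edge[of "{b3}" b2]) (use V in auto)
  then have v3: "v3 \<in> C" "(b3, v3) \<in> E"
    using V nR E_R R_commute by auto
  then have "v3 = c"
    using path[of c v3] c E_R by auto
  with v3 have c3: "(b3, c) \<in> E" by simp
  have only: "(b1, y) \<notin> E" "(b2, y) \<notin> E" "(b3, y) \<notin> E" if "y \<in> C" "y \<noteq> c" for y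
    using path[of y c] path[of c y] that c c3 E_R by blast+
  obtain c0 where c0: "c0 \<in> C" "c0 \<notin> {c}" by (rule fresh_in_C[of "{c}"]) auto
  obtain u y where "u \<in> {b1, b2, b3, c}" "y \<in> V - {b1, b2, b3, c}" "(u, y) \<in> E"
    by (rule cut_edge[of "{b1, b2, b3, c}" c0]) (use V c0 c in auto)
  then have y: "(c, y) \<in> E" "y \<in> C" "y \<noteq> c"
    using only V by auto
  have "distinct [b2, b3, y]" using V y by auto
  from claw[OF E_sym[OF c(2)] E_sym[OF c3] y(1) this] show False
    using only[OF y(2,3)] nR(2) E_R by blast
qed

text \<open>By \<open>no_spanning_path_of_B\<close> such an edge leaves \<open>b3\<close>
  non-adjacent to both ends, so the arc of \<open>E\<close> leaving {b1, b2} enters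
  \<open>C\<close>. Up to swapping the two ends it starts at \<open>b2\<close>.\<close>

lemma no_edge_in_B:
  assumes sp: "split_off b1 b2 b3"
  shows "(b1, b2) \<notin> R"
proof
  assume R12: "(b1, b2) \<in> R"
  have V: "V = {b1, b2, b3} \<union> C" "distinct [b1, b2, b3]" "{b1, b2, b3} \<inter> C = {}"
    using sp by (auto simp: split_off_def)
  have nR: "(b2, b3) \<notin> R" "(b1, b3) \<notin> R"
    using no_spanning_path_of_B[OF sp R12] no_spanning_path_of_B[OF split_off_perm(1)[OF sp] R_sym[OF R12]] by auto
  obtain c0 where c0: "c0 \<in> C" by (rule fresh_in_C[of "{}"]) auto
  obtain u c where "u \<in> {b1, b2}" "c \<in> V - {b1, b2}" "(u, c) \<in> E"
    by (rule cut_edge[of "{b1, b2}" c0]) (use V c0 in auto)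
  then have "c \<in> C" "(b1, c) \<in> E \<or> (b2, c) \<in> E"
    using V nR E_R by auto
  then show False
    using no_edge_in_B_aux[OF sp R12 nR(2,1)] no_edge_in_B_aux[OF split_off_perm(1)[OF sp] R_sym[OF R12] nR]
    by blast
qed

section \<open>Three pairwise non-adjacent vertices outside the clique\<close>

lemma B_independent:
  assumes sp: "split_off b1 b2 b3"
  shows "(b1, b2) \<notin> R" "(b1, b3) \<notin> R" "(b2, b3) \<notin> R"
    and "(b2, b1) \<notin> R" "(b3, b1) \<notin> R" "(b3, b2) \<notin> R"
proof -
  note p = split_off_perm
  show "(b1, b2) \<notin> R" by (rule no_edge_in_B[OF sp])
  show "(b1, b3) \<notin> R" by (rule no_edge_in_B[OF p(2)[OF sp]])
  show "(b2, b3) \<notin> R" by (rule no_edge_in_B[OF p(2)[OF p(1)[OF sp]]])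
  show "(b2, b1) \<notin> R" by (rule no_edge_in_B[OF p(1)[OF sp]])
  show "(b3, b1) \<notin> R" by (rule no_edge_in_B[OF p(1)[OF p(2)[OF sp]]])
  show "(b3, b2) \<notin> R" by (rule no_edge_in_B[OF p(1)[OF p(2)[OF p(1)[OF sp]]]])
qed

lemma no_three_neighbours:
  assumes sp: "split_off b1 b2 b3" and a: "(b1, a) \<in> E" "(b2, a) \<in> E" "(b3, a) \<in> E"
  shows False
proof -
  have "distinct [b1, b2, b3]"
    using sp by (simp add: split_off_def)
  from claw[OF E_sym[OF a(1)] E_sym[OF a(2)] E_sym[OF a(3)] this] show False
    using B_independent[OF sp] E_R by blast
qed

text \<open>The path b1, a, b2, c forces every \<open>E\<close>-neighbour of \<open>b3\<close> to be
  \<open>c\<close>. It follows that no arc of \<open>E\<close> joins the three vertices to the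
  clique outside {a, c}, so connectedness supplies an arc from \<open>a\<close> or \<open>c\<close>
  to some \<open>d\<close>. This completes a claw, with leaves b1, b2, d at \<open>a\<close> or b2,
  b3, d at \<open>c\<close>.\<close>

lemma no_common_neighbour_aux:
  assumes sp: "split_off b1 b2 b3" and a: "a \<in> C" "(b1, a) \<in> E" "(b2, a) \<in> E"
    and c: "c \<in> C" "(b2, c) \<in> E" "c \<noteq> a"
  shows False
proof -
  have V: "V = {b1, b2, b3} \<union> C" "distinct [b1, b2, b3]" "{b1, b2, b3} \<inter> C = {}"
    using sp by (auto simp: split_off_def)
  note indep = B_independent[OF sp]
  have na: "(b3, a) \<notin> E"
    using no_three_neighbours[OF sp a(2,3)] by blast
  have path: False if "y \<in> C" "(b2, y) \<in> E" "y \<noteq> a" "z \<in> C" "z \<noteq> y" "(b3, z) \<in> E" for y z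
    by (rule no_two_ended_path[of "[b1, a, b2, y]" "[z, b3]"])
      (use V that na a E_R R_commute in auto)
  obtain v3 where "v3 \<in> V - {b3}" "(b3, v3) \<in> E"
    by (rule cut_edge[of "{b3}" b2]) (use V in auto)
  then have v3: "v3 \<in> C" "(b3, v3) \<in> E"
    using V indep E_R by auto
  then have "v3 = c"
    using path[of c v3] c by auto
  with v3 have c3: "(b3, c) \<in> E" by simp
  have only: "(b1, d) \<notin> E" "(b2, d) \<notin> E" "(b3, d) \<notin> E" if d: "d \<in> C" "d \<noteq> a" "d \<noteq> c" for d
  proof -
    show "(b2, d) \<notin> E" using path[of d c] d c c3 by auto
    show "(b3, d) \<notin> E" using path[of c d] d c by auto
    show "(b1, d) \<notin> E"
    proof
      assume bd: "(b1, d) \<in> E"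
      \<comment> \<open>The path b3, c, b2, a, b1, d ends in the clique but uses three of its
        vertices; a fourth is needed to serve as the second path.\<close>
      obtain e where e: "e \<in> C" "e \<notin> {a, c, d}"
        by (rule fresh_in_C[of "{a, c, d}"]) (auto simp: card_insert_if)
      show False
        by (rule no_two_ended_path[of "[b3, c, b2, a, b1, d]" "[e]"])
          (use V d e bd a c c3 E_R R_commute in auto)
    qed
  qed
  obtain c0 where c0: "c0 \<in> C" "c0 \<notin> {a, c}"
    by (rule fresh_in_C[of "{a, c}"]) (auto simp: card_insert_if)
  obtain u d where ud: "u \<in> {b1, b2, b3, a, c}" "d \<in> V - {b1, b2, b3, a, c}" "(u, d) \<in> E"
    by (rule cut_edge[of "{b1, b2, b3, a, c}" c0]) (use V c0 c a in auto)
  then have d: "d \<in> C" "d \<noteq> a" "d \<noteq> c" using V by auto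
  from ud only[OF d] consider "(a, d) \<in> E" | "(c, d) \<in> E" by auto
  then show False
  proof cases
    case 1
    have "distinct [b1, b2, d]" using V d by auto
    from claw[OF E_sym[OF a(2)] E_sym[OF a(3)] 1 this] show False
      using only[OF d] indep E_R by blast
  next
    case 2
    have "distinct [b2, b3, d]" using V d by auto
    from claw[OF E_sym[OF c(2)] E_sym[OF c3] 2 this] show False
      using only[OF d] indep E_R by blast
  qed
qed

text \<open>Connectedness gives an arc from {b1, b2, a} to a second clique vertex \<open>c\<close>.
  If it starts at \<open>a\<close>, claw-freeness at \<open>a\<close> moves its start to
  \<open>b1\<close> or \<open>b2\<close>, so one of these two has two clique neighbours.\<close>

lemma no_common_neighbour:
  assumes sp: "split_off b1 b2 b3" and a: "a \<in> C" "(b1, a) \<in> E" "(b2, a) \<in> E"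
  shows False
proof -
  have V: "V = {b1, b2, b3} \<union> C" "distinct [b1, b2, b3]" "{b1, b2, b3} \<inter> C = {}"
    using sp by (auto simp: split_off_def)
  note indep = B_independent[OF sp]
  have na: "(b3, a) \<notin> E"
    using no_three_neighbours[OF sp a(2,3)] by blast
  obtain u c where uc: "u \<in> {b1, b2, a}" "c \<in> V - {b1, b2, a}" "(u, c) \<in> E"
    by (rule cut_edge[of "{b1, b2, a}" b3]) (use V a in auto)
  then have c: "c \<in> C" "c \<noteq> a"
    using V indep na E_sym E_R by blast+
  have "(b1, c) \<in> E \<or> (b2, c) \<in> E"
  proof (cases "u = a")
    case True
    have "distinct [b1, b2, c]" using V c by auto
    from claw[OF E_sym[OF a(2)] E_sym[OF a(3)] uc(3)[unfolded True] this] show ?thesis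
      using indep E_R by blast
  qed (use uc in auto)
  then show False
    using no_common_neighbour_aux[OF sp a c(1) _ c(2)]
      no_common_neighbour_aux[OF split_off_perm(1)[OF sp] a(1,3,2) c(1) _ c(2)] by blast
qed

lemma neighbours_disjoint:
  assumes sp: "split_off b1 b2 b3" and "x \<in> {b1, b2, b3}" "y \<in> {b1, b2, b3}" "(x, a) \<in> E" "(y, a) \<in> E" "a \<in> C"
  shows "x = y"
proof -
  note p = split_off_perm and nc = no_common_neighbour
  have "\<not> ((b1, a) \<in> E \<and> (b2, a) \<in> E)"
    using nc[OF sp assms(6)] by blast
  moreover have "\<not> ((b1, a) \<in> E \<and> (b3, a) \<in> E)"
    using nc[OF p(2)[OF sp] assms(6)] by blast
  moreover have "\<not> ((b2, a) \<in> E \<and> (b3, a) \<in> E)"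
    using nc[OF p(2)[OF p(1)[OF sp]] assms(6)] by blast
  ultimately show ?thesis
    using assms(2-5) by auto
qed

lemma neighbour_in_C:
  assumes sp: "split_off b1 b2 b3"
  obtains a where "a \<in> C" "(b1, a) \<in> E"
proof -
  have V: "V = {b1, b2, b3} \<union> C" "distinct [b1, b2, b3]"
    using sp by (auto simp: split_off_def)
  obtain u a where "u \<in> {b1}" "a \<in> V - {b1}" "(u, a) \<in> E"
    by (rule cut_edge[of "{b1}" b2]) (use V in auto)
  then have "a \<in> C" "(b1, a) \<in> E"
    using V B_independent[OF sp] E_R by auto
  then show ?thesis by (rule that)
qed

text \<open>With disjoint neighbourhoods, a vertex with two neighbours can be inserted between them:
  b2, a2, a, b1, a', then the rest of the clique, then a3, b3.\<close>

lemma unique_neighbour: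
  assumes sp: "split_off b1 b2 b3" and a: "(b1, a) \<in> E" "(b1, a') \<in> E"
  shows "a = a'"
proof (rule ccontr)
  assume neq: "a \<noteq> a'"
  have V: "V = {b1, b2, b3} \<union> C" "distinct [b1, b2, b3]" "{b1, b2, b3} \<inter> C = {}"
    using sp by (auto simp: split_off_def)
  have sp2: "split_off b2 b1 b3" and sp3: "split_off b3 b1 b2"
    using split_off_perm(1)[OF sp] split_off_perm(1)[OF split_off_perm(2)[OF sp]] by simp_all
  have C: "v \<in> C" if "(b1, v) \<in> E" for v
    using that EV V E_neq[OF that] B_independent[OF sp] E_R[OF that] by auto
  note C = C[OF a(1)] C[OF a(2)]
  obtain a2 where a2: "a2 \<in> C" "(b2, a2) \<in> E" by (rule neighbour_in_C[OF sp2])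
  obtain a3 where a3: "a3 \<in> C" "(b3, a3) \<in> E" by (rule neighbour_in_C[OF sp3])
  have "distinct [a, a', a2, a3]"
    using neq neighbours_disjoint[OF sp, of b1 b2] neighbours_disjoint[OF sp, of b1 b3]
      neighbours_disjoint[OF sp, of b2 b3] a a2 a3 C V(2) by auto
  moreover have "(a2, a) \<in> R" "(a, b1) \<in> R"
    using clique[OF a2(1) C(1)] calculation R_sym[OF E_R[OF a(1)]] by auto
  ultimately show False
    by (intro no_two_ended_path[of "[b2, a2, a, b1, a']" "[a3, b3]"])
      (use V C a2(1) a3(1) E_R[OF a(2)] E_R[OF a2(2)] R_sym[OF E_R[OF a3(2)]] in auto)
qed

lemma three_pendant_vertices:
  assumes sp: "split_off b1 b2 b3" and B: "B = {b1, b2, b3}"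
  obtains g where "inj_on g B" "g ` B \<subseteq> C" "\<And>b v. b \<in> B \<Longrightarrow> (b, v) \<in> E \<longleftrightarrow> v = g b"
proof -
  have "\<exists>a\<in>C. \<forall>v. (b, v) \<in> E \<longleftrightarrow> v = a" if b: "b \<in> B" for b
  proof -
    have "split_off b2 b1 b3" "split_off b3 b1 b2"
      using split_off_perm(1)[OF sp] split_off_perm(1)[OF split_off_perm(2)[OF sp]] by simp_all
    then obtain x y where xy: "split_off b x y"
      using b sp unfolding B by blast
    obtain a where "a \<in> C" "(b, a) \<in> E"
      by (rule neighbour_in_C[OF xy])
    then show ?thesis
      using unique_neighbour[OF xy] by blast
  qed
  then obtain g where g: "\<And>b. b \<in> B \<Longrightarrow> g b \<in> C" "\<And>b v. b \<in> B \<Longrightarrow> (b, v) \<in> E \<longleftrightarrow> v = g b"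
    by metis
  moreover have "inj_on g B"
    using neighbours_disjoint[OF sp] g unfolding inj_on_def B by metis
  ultimately show ?thesis
    using that by blast
qed

end

section \<open>Edge-maximal graphs without a Hamilton path\<close>

definition non_edges :: "'a set \<Rightarrow> 'a rel \<Rightarrow> 'a rel" where
  "non_edges V R = {(u, v). u \<in> V \<and> v \<in> V \<and> u \<noteq> v \<and> (u, v) \<notin> R}"

lemma maximal_without_hamilton_path:
  assumes "finite V" "R0 \<subseteq> V \<times> V" "sym R0" "irrefl R0" "\<not> has_hamilton_path V R0"
  obtains R where "R0 \<subseteq> R" "R \<subseteq> V \<times> V" "sym R" "irrefl R" "\<not> has_hamilton_path V R"
    and "\<And>u v. (u, v) \<in> non_edges V R \<Longrightarrow> has_hamilton_path V (R \<union> {(u, v), (v, u)})"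
proof -
  define F where "F = {R. R \<subseteq> V \<times> V \<and> sym R \<and> irrefl R \<and> \<not> has_hamilton_path V R}"
  have "F \<subseteq> Pow (V \<times> V)" by (auto simp: F_def)
  then have "finite F"
    by (rule finite_subset) (simp add: assms(1))
  moreover have "R0 \<in> F" using assms by (simp add: F_def)
  ultimately obtain R where R: "R \<in> F" "R0 \<subseteq> R" "\<And>S. S \<in> F \<Longrightarrow> R \<subseteq> S \<Longrightarrow> R = S"
    using finite_has_maximal2 by metis
  have "has_hamilton_path V (R \<union> {(u, v), (v, u)})" if uv: "(u, v) \<in> non_edges V R" for u v
  proof (rule ccontr)
    assume "\<not> ?thesis"
    then have "R \<union> {(u, v), (v, u)} \<in> F"
      using uv R(1) by (auto simp: F_def non_edges_def sym_def irrefl_def)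
    then have "(u, v) \<in> R" using R(3)[of "R \<union> {(u, v), (v, u)}"] by blast
    then show False using uv by (simp add: non_edges_def)
  qed
  then show ?thesis using R(1,2) that unfolding F_def by blast
qed

text \<open>Here \<open>u = last xs\<close> and \<open>v = hd ys\<close> are the ends of a missing
  edge. If u is adjacent to position j and v to position j+1, reversing a segment yields a Hamilton
  path. Hence the neighbour positions of u, shifted by one, avoid those of v, and both sets lie in
  the same n-2 positions.\<close>

lemma crossing_degree_sum:
  assumes nonham: "\<not> has_hamilton_path V R" and symR: "sym R" and irr: "irrefl R" and RV: "R \<subseteq> V \<times> V"
    and p: "distinct (xs @ ys)" "set (xs @ ys) = V" "xs \<noteq> []" "ys \<noteq> []"
    and sx: "successively (\<lambda>u v. (u, v) \<in> R) xs" and sy: "successively (\<lambda>u v. (u, v) \<in> R) ys"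
  shows "card (R `` {last xs}) + card (R `` {hd ys}) + 2 \<le> card V"
proof -
  define u v where "u = last xs" and "v = hd ys"
  define q where "q = xs @ ys"
  define n m where "n = length q" and "m = length xs"
  have R_sym: "(a, b) \<in> R \<Longrightarrow> (b, a) \<in> R" for a b
    by (rule symD[OF symR])
  have rev_R: "successively (\<lambda>u v. (u, v) \<in> R) (rev zs) \<longleftrightarrow> successively (\<lambda>u v. (u, v) \<in> R) zs" for zs
  proof -
    have "(\<lambda>x y. (y, x) \<in> R) = (\<lambda>x y. (x, y) \<in> R)" using R_sym by blast
    then have "successively (\<lambda>x y. (y, x) \<in> R) zs = successively (\<lambda>x y. (x, y) \<in> R) zs"
      by (rule arg_cong)
    then show ?thesis by simp
  qed
  have no_path: False if "distinct zs" "set zs = V" "successively (\<lambda>u v. (u, v) \<in> R) zs" for zs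
    using nonham that by (auto simp: has_hamilton_path_def)
  have m: "0 < m" "m < n" using p by (auto simp: m_def n_def q_def)
  have qu: "q ! (m - 1) = u" and qv: "q ! m = v"
    using p m by (auto simp: q_def m_def u_def v_def nth_append last_conv_nth hd_conv_nth)
  \<comment> \<open>Otherwise \<open>xs\<close> followed by the reversed \<open>ys\<close> is a
    Hamilton path; \<open>first\<close> is the mirror image.\<close>
  have last: "(u, q ! (n - 1)) \<notin> R"
  proof
    assume "(u, q ! (n - 1)) \<in> R"
    moreover have "q ! (n - 1) = last ys"
      using p last_conv_nth[of q] by (simp add: q_def n_def)
    ultimately have "successively (\<lambda>u v. (u, v) \<in> R) (xs @ rev ys)"
      using sx sy p rev_R by (simp add: successively_append_iff hd_rev u_def)
    then show False using p by (intro no_path[of "xs @ rev ys"]) auto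
  qed
  have first: "(v, q ! 0) \<notin> R"
  proof
    assume "(v, q ! 0) \<in> R"
    moreover have "q ! 0 = hd xs"
      using p by (simp add: q_def nth_append hd_conv_nth)
    ultimately have "successively (\<lambda>u v. (u, v) \<in> R) (rev xs @ ys)"
      using sx sy p rev_R R_sym by (simp add: successively_append_iff last_rev v_def)
    then show False using p by (intro no_path[of "rev xs @ ys"]) auto
  qed
  \<comment> \<open>Crossing inside \<open>xs\<close>: go to x, jump to u, run back to y, then jump
    to v and follow \<open>ys\<close>.\<close>
  have left: False if j: "Suc j < m" "(u, q ! j) \<in> R" "(v, q ! Suc j) \<in> R" for j
  proof -
    define as x y bs where "as = take j xs" and "x = xs ! j" and "y = xs ! Suc j" and "bs = drop (Suc (Suc j)) xs"
    have "drop (Suc j) xs = y # bs" "xs = take j xs @ xs ! j # drop (Suc j) xs"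
      using j id_take_nth_drop[of j xs] by (simp_all add: y_def bs_def m_def Cons_nth_drop_Suc)
    then have xs: "xs = as @ x # y # bs"
      unfolding as_def x_def by metis
    have "q ! j = x" "q ! Suc j = y"
      using j by (simp_all add: q_def nth_append m_def x_def y_def)
    with j have R: "(u, x) \<in> R" "(v, y) \<in> R" by simp_all
    have "u = last (y # bs)" using xs by (simp add: u_def)
    then have xy: "(x, last (y # bs)) \<in> R" "(y, hd ys) \<in> R"
      using R R_sym v_def by metis+
    have "successively (\<lambda>u v. (u, v) \<in> R) (as @ [x])" "successively (\<lambda>u v. (u, v) \<in> R) (y # bs)"
      using sx unfolding xs by (auto simp: successively_append_iff successively_Cons)
    then have "successively (\<lambda>u v. (u, v) \<in> R) ((as @ [x]) @ rev (y # bs) @ ys)"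
      unfolding successively_append_iff[of _ "as @ [x]"] successively_append_iff[of _ "rev (y # bs)"] rev_R
      using xy sy by (simp add: hd_append hd_rev split: if_splits)
    moreover have "distinct ((as @ [x]) @ rev (y # bs) @ ys)" "set ((as @ [x]) @ rev (y # bs) @ ys) = V"
      using p unfolding xs by auto
    ultimately show False by (intro no_path)
  qed
  \<comment> \<open>Crossing inside \<open>ys\<close>: follow \<open>xs\<close> to u, jump to x, run
    back to v, then jump to y and finish.\<close>
  have right: False if j: "m \<le> j" "Suc j < n" "(u, q ! j) \<in> R" "(v, q ! Suc j) \<in> R" for j
  proof -
    define i where "i = j - m"
    have i: "j = m + i" "Suc i < length ys"
      using j by (auto simp: i_def n_def q_def m_def)
    define as x y bs where "as = take i ys" and "x = ys ! i" and "y = ys ! Suc i" and "bs = drop (Suc (Suc i)) ys"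
    have "drop (Suc i) ys = y # bs" "ys = take i ys @ ys ! i # drop (Suc i) ys"
      using i id_take_nth_drop[of i ys] by (simp_all add: y_def bs_def Cons_nth_drop_Suc)
    then have ys: "ys = as @ x # y # bs"
      unfolding as_def x_def by metis
    have "q ! j = x" "q ! Suc j = y"
      using i by (simp_all add: q_def nth_append m_def x_def y_def)
    with j have R: "(u, x) \<in> R" "(v, y) \<in> R" by simp_all
    have "v = hd (as @ [x])" using ys by (simp add: v_def hd_append)
    then have xy: "(last xs, x) \<in> R" "(hd (as @ [x]), y) \<in> R"
      using R u_def by metis+
    have "successively (\<lambda>u v. (u, v) \<in> R) (as @ [x])" "successively (\<lambda>u v. (u, v) \<in> R) (y # bs)"
      using sy unfolding ys by (auto simp: successively_append_iff successively_Cons)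
    then have "successively (\<lambda>u v. (u, v) \<in> R) (xs @ rev (as @ [x]) @ y # bs)"
      unfolding successively_append_iff[of _ xs] successively_append_iff[of _ "rev (as @ [x])"] rev_R
      using xy sx p(3) by (simp add: last_rev hd_append split: if_splits)
    moreover have "distinct (xs @ rev (as @ [x]) @ y # bs)" "set (xs @ rev (as @ [x]) @ y # bs) = V"
      using p unfolding ys by auto
    ultimately show False by (intro no_path)
  qed
  define I where "I w = {j. j < n \<and> (w, q ! j) \<in> R}" for w
  have cardI: "card (R `` {w}) = card (I w)" for w
  proof -
    have "R `` {w} = {x \<in> set q. (w, x) \<in> R}"
      using RV p(2) by (auto simp: q_def)
    also have "\<dots> = (!) q ` I w"
      by (auto simp: I_def n_def in_set_conv_nth)
    finally have "R `` {w} = (!) q ` I w" .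
    moreover have "inj_on ((!) q) (I w)"
      using p(1) unfolding q_def[symmetric] by (intro inj_on_nth) (auto simp: I_def n_def)
    ultimately show ?thesis by (simp add: card_image)
  qed
  have nloop: "(w, w) \<notin> R" for w using irr by (simp add: irrefl_def)
  have "Suc ` I u \<inter> I v = {}"
  proof (rule ccontr)
    assume "\<not> ?thesis"
    then obtain j where j: "Suc j < n" "(u, q ! j) \<in> R" "(v, q ! Suc j) \<in> R"
      by (auto simp: I_def)
    consider "Suc j < m" | "Suc j = m" | "m \<le> j" by linarith
    then show False
    proof cases
      case 2
      then have "j = m - 1" by simp
      then show False using j(2) qu nloop by simp
    qed (use left right j in auto)
  qed
  \<comment> \<open>Position \<open>m\<close> is missing because u sits at \<open>m - 1\<close> and
    is not its own neighbour; the shift stays below \<open>n\<close> because u is not adjacent to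
    the last vertex.\<close>
  moreover have "Suc ` I u \<subseteq> {1..<n} - {m}"
  proof
    fix k assume "k \<in> Suc ` I u"
    then obtain j where j: "k = Suc j" "j < n" "(u, q ! j) \<in> R" by (auto simp: I_def)
    have "j \<noteq> n - 1" using j last by metis
    moreover have "j \<noteq> m - 1" using j qu nloop by metis
    ultimately show "k \<in> {1..<n} - {m}" using j by auto
  qed
  moreover have "I v \<subseteq> {1..<n} - {m}"
  proof
    fix k assume "k \<in> I v"
    then have k: "k < n" "(v, q ! k) \<in> R" by (auto simp: I_def)
    have "k \<noteq> 0" using k first by metis
    moreover have "k \<noteq> m" using k qv nloop by metis
    ultimately show "k \<in> {1..<n} - {m}" using k by auto
  qed
  ultimately have "card (Suc ` I u) + card (I v) \<le> card ({1..<n} - {m})"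
    by (subst card_Un_disjoint[symmetric]) (auto simp: I_def intro!: card_mono)
  also have "\<dots> = n - 2"
    using m by simp
  finally have "card (I u) + card (I v) + 2 \<le> n"
    using m by (simp add: card_image)
  moreover have "n = card V"
    using p distinct_card unfolding n_def q_def by metis
  ultimately show ?thesis
    by (simp add: cardI u_def v_def)
qed

lemma card_non_edges_neighbours:
  assumes "finite V" "R \<subseteq> V \<times> V" "irrefl R" "u \<in> V"
  shows "card (non_edges V R `` {u}) + card (R `` {u}) + 1 = card V"
proof -
  have "V = insert u (non_edges V R `` {u} \<union> R `` {u})" "u \<notin> non_edges V R `` {u} \<union> R `` {u}"
    "non_edges V R `` {u} \<inter> R `` {u} = {}"
    using assms by (auto simp: non_edges_def irrefl_def)
  moreover have "finite (non_edges V R `` {u})" "finite (R `` {u})"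
    using assms by (auto simp: non_edges_def intro: finite_subset)
  ultimately show ?thesis
    by (metis (no_types, lifting) Suc_eq_plus1 card_Un_disjoint card_insert_disjoint finite_UnI)
qed

text \<open>A Hamilton path that exists only after adding uv splits at that edge into two
  \<open>R\<close>-paths. The bound n-2 on the degree sum in \<open>R\<close> becomes 2(n-1) - (n-2)
  = n in the complement.\<close>

lemma non_edges_degree_sum:
  assumes fin: "finite V" and RV: "R \<subseteq> V \<times> V" and symR: "sym R" and irr: "irrefl R"
    and nonham: "\<not> has_hamilton_path V R"
    and uv: "(u, v) \<in> non_edges V R" and ham: "has_hamilton_path V (R \<union> {(u, v), (v, u)})"
  shows "card V \<le> card (non_edges V R `` {u}) + card (non_edges V R `` {v})"
proof -
  obtain p where p: "distinct p" "set p = V" "successively (\<lambda>a b. (a, b) \<in> R \<union> {(u, v), (v, u)}) p"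
    using ham by (auto simp: has_hamilton_path_def)
  have "\<not> successively (\<lambda>a b. (a, b) \<in> R) p"
    using nonham p by (auto simp: has_hamilton_path_def)
  then obtain i where i: "Suc i < length p" "(p ! i, p ! Suc i) \<notin> R"
    by (auto simp: successively_conv_nth)
  \<comment> \<open>A list of distinct vertices can traverse the new edge only once.\<close>
  have step: "(p ! j, p ! Suc j) \<in> R" if j: "Suc j < length p" "j \<noteq> i" for j
  proof (rule ccontr)
    assume nR: "(p ! j, p ! Suc j) \<notin> R"
    have "{p ! j, p ! Suc j} = {u, v}" "{p ! i, p ! Suc i} = {u, v}"
      using p(3) i j nR by (auto simp: successively_conv_nth)
    then have "{p ! j, p ! Suc j} = {p ! i, p ! Suc i}" by simp
    then have "{j, Suc j} = {i, Suc i}"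
      using p(1) i j by (auto simp: doubleton_eq_iff nth_eq_iff_index_eq)
    then show False using j unfolding doubleton_eq_iff by presburger
  qed
  let ?xs = "take (Suc i) p" and ?ys = "drop (Suc i) p"
  have "card (R `` {last ?xs}) + card (R `` {hd ?ys}) + 2 \<le> card V"
  proof (rule crossing_degree_sum[OF nonham symR irr RV])
    show "successively (\<lambda>a b. (a, b) \<in> R) ?xs" "successively (\<lambda>a b. (a, b) \<in> R) ?ys"
      using step i by (auto simp: successively_conv_nth)
  qed (use p i in auto)
  moreover have "last ?xs = p ! i" "hd ?ys = p ! Suc i"
    using i by (simp_all add: take_Suc_conv_app_nth hd_drop_conv_nth)
  moreover have "p ! i = u \<and> p ! Suc i = v \<or> p ! i = v \<and> p ! Suc i = u"
    using p(3) i by (auto simp: successively_conv_nth)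
  ultimately have "card (R `` {u}) + card (R `` {v}) + 2 \<le> card V"
    by auto
  moreover have "u \<in> V" "v \<in> V" using uv by (auto simp: non_edges_def)
  ultimately show ?thesis
    using card_non_edges_neighbours[OF fin RV irr, of u] card_non_edges_neighbours[OF fin RV irr, of v]
    by linarith
qed

section \<open>Vertices of large degree in the complement\<close>

lemma nbr_sum_two_valued:
  fixes a b :: real
  assumes "S \<subseteq> V \<times> V" "finite V" "B \<subseteq> V"
  shows "nbr_sum S (\<lambda>v. if v \<in> B then a else b) u = card (S `` {u} \<inter> B) * a + card (S `` {u} - B) * b"
proof -
  have fin: "finite (S `` {u})"
    using assms by (auto intro: finite_subset)
  then have "nbr_sum S (\<lambda>v. if v \<in> B then a else b) u
      = (\<Sum>v\<in>S `` {u} \<inter> B. a) + (\<Sum>v\<in>S `` {u} \<inter> - B. b)"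
    unfolding nbr_sum_def by (subst sum.If_cases) (simp_all add: Collect_mem_eq)
  then show ?thesis by (simp add: Diff_eq)
qed

lemma sum_card_neighbours_swap:
  assumes "sym S" "finite A" "finite B"
  shows "(\<Sum>a\<in>A. card (S `` {a} \<inter> B)) = (\<Sum>b\<in>B. card (S `` {b} \<inter> A))"
proof -
  have count: "card (S `` {u} \<inter> W) = (\<Sum>w\<in>W. if (u, w) \<in> S then 1 else 0)" if "finite W" for u W
  proof -
    have "S `` {u} \<inter> W = {w \<in> W. (u, w) \<in> S}" by auto
    then show ?thesis using that by (simp add: sum.If_cases Collect_conj_eq Int_commute)
  qed
  have "(\<Sum>a\<in>A. card (S `` {a} \<inter> B)) = (\<Sum>a\<in>A. \<Sum>b\<in>B. if (a, b) \<in> S then 1 else 0)"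
    using assms by (simp add: count)
  also have "\<dots> = (\<Sum>b\<in>B. \<Sum>a\<in>A. if (a, b) \<in> S then 1 else 0)"
    by (rule sum.swap)
  also have "\<dots> = (\<Sum>b\<in>B. \<Sum>a\<in>A. if (b, a) \<in> S then 1 else 0)"
    using assms(1) by (auto intro!: sum.cong simp: sym_def)
  finally show ?thesis using assms by (simp add: count)
qed

text \<open>\<open>S\<close> is meant to be the complement of \<open>R\<close>, and \<mu> the
  spectral radius of the possibly larger complement of the original graph. The two spectral
  assumptions are therefore limited to nonnegative vectors, for which they are inherited.\<close>

locale ore_graph =
  fixes V :: "'a set" and S :: "'a rel" and \<mu> :: real
  assumes fin: "finite V" and SV: "S \<subseteq> V \<times> V" and symS: "sym S" and irrS: "irrefl S"
    and ore: "(u, v) \<in> S \<Longrightarrow> card V \<le> card (S `` {u}) + card (S `` {v})"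
    and norm_le: "(\<And>v. x v \<ge> 0) \<Longrightarrow> (\<Sum>u\<in>V. (nbr_sum S x u)\<^sup>2) \<le> \<mu>\<^sup>2 * (\<Sum>u\<in>V. (x u)\<^sup>2)"
    and rayleigh_le: "(\<And>v. x v \<ge> 0) \<Longrightarrow> (\<Sum>u\<in>V. x u * nbr_sum S x u) \<le> \<mu> * (\<Sum>u\<in>V. (x u)\<^sup>2)"
    and \<mu>_nonneg: "\<mu> \<ge> 0" and \<mu>_le: "\<mu> \<le> 1 + sqrt (3 * real (card V) - 13)"
    and large: "card V \<ge> 24"
begin

abbreviation deg :: "'a \<Rightarrow> nat" where "deg v \<equiv> card (S `` {v})"

definition heavy :: "'a set" where "heavy = {v \<in> V. card V \<le> 2 * deg v}"

lemma finite_nbrs: "finite (S `` {v})"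
  using SV fin by (auto intro: finite_subset)

text \<open>A linear bound in n for a quantity involving a square root: the tangent at s = 8, which
  corresponds to n between 25 and 26, loses little at the smallest n.\<close>

lemma \<mu>_sq_le: "8 * \<mu>\<^sup>2 \<le> 27 * real (card V) - 45"
proof -
  define s where "s = sqrt (3 * real (card V) - 13)"
  have s: "s\<^sup>2 = 3 * real (card V) - 13" using large by (simp add: s_def)
  have "\<mu>\<^sup>2 \<le> (1 + s)\<^sup>2"
    using \<mu>_nonneg \<mu>_le by (intro power_mono) (simp_all add: s_def)
  moreover have "8 * (1 + s)\<^sup>2 \<le> 72 + 9 * s\<^sup>2"
    using zero_le_power2[of "s - 8"] by (simp add: power2_eq_square algebra_simps)
  ultimately show ?thesis unfolding s using large by simp
qed

text \<open>Summing \<open>ore\<close> over all arcs bounds \<open>card V\<close> times the sum of the degrees by twice the sum of the squared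
  degrees, which is the squared norm of the image of the all-ones vector.\<close>

lemma sum_deg_le: "(\<Sum>v\<in>V. real (deg v)) \<le> 2 * \<mu>\<^sup>2"
proof -
  let ?d = "\<lambda>v. real (deg v)" and ?n = "real (card V)"
  have "?n * ?d u \<le> nbr_sum S (\<lambda>v. ?d u + ?d v) u" for u
  proof -
    have "(\<Sum>v\<in>S `` {u}. ?n) \<le> (\<Sum>v\<in>S `` {u}. ?d u + ?d v)"
      using ore by (intro sum_mono) (simp flip: of_nat_add)
    then show ?thesis by (simp add: nbr_sum_def mult.commute)
  qed
  then have "(\<Sum>u\<in>V. ?n * ?d u) \<le> (\<Sum>u\<in>V. nbr_sum S (\<lambda>v. ?d u + ?d v) u)"
    by (intro sum_mono)
  also have "\<dots> = (\<Sum>u\<in>V. (?d u)\<^sup>2 + nbr_sum S ?d u)"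
    by (simp add: nbr_sum_def sum.distrib power2_eq_square)
  also have "\<dots> = (\<Sum>u\<in>V. (?d u)\<^sup>2) + (\<Sum>u\<in>V. 1 * nbr_sum S ?d u)"
    by (simp add: sum.distrib)
  also have "(\<Sum>u\<in>V. 1 * nbr_sum S ?d u) = (\<Sum>u\<in>V. (?d u)\<^sup>2)"
    \<comment> \<open>The operator is moved onto the constant vector 1, whose image is the degree
      function.\<close>
    by (subst nbr_sum_self_adjoint[OF fin SV symS]) (simp add: nbr_sum_def power2_eq_square)
  also have "(\<Sum>u\<in>V. (?d u)\<^sup>2) \<le> \<mu>\<^sup>2 * ?n"
    using norm_le[of "\<lambda>_. 1"] by (simp add: nbr_sum_def)
  finally have "?n * (\<Sum>u\<in>V. ?d u) \<le> ?n * (2 * \<mu>\<^sup>2)"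
    by (simp add: sum_distrib_left algebra_simps)
  then show ?thesis using large by simp
qed

section \<open>Counting degrees of heavy and light vertices\<close>

lemma heavy_subset: "heavy \<subseteq> V" and finite_heavy: "finite heavy"
  using fin by (auto simp: heavy_def)

lemma nbrs_of_light:
  assumes "c \<in> V - heavy"
  shows "S `` {c} \<subseteq> heavy"
proof
  fix v assume v: "v \<in> S `` {c}"
  then have "card V \<le> deg c + deg v" using ore by auto
  then show "v \<in> heavy" using assms v SV by (auto simp: heavy_def)
qed

lemma light_independent:
  assumes "u \<in> V - heavy" "v \<in> V - heavy"
  shows "(u, v) \<notin> S"
  using nbrs_of_light[OF assms(1)] assms(2) by blast

lemma card_nbrs_in_heavy:
  assumes "b \<in> heavy"
  shows "card (S `` {b} \<inter> heavy) + 1 \<le> card heavy"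
proof -
  have "insert b (S `` {b} \<inter> heavy) \<subseteq> heavy" "b \<notin> S `` {b} \<inter> heavy"
    using assms irrS by (auto simp: irrefl_def)
  then show ?thesis
    using card_mono[OF finite_heavy] finite_nbrs by (metis card_insert_disjoint finite_Int Suc_eq_plus1)
qed

lemma deg_split: "deg b = card (S `` {b} \<inter> heavy) + card (S `` {b} - heavy)"
  using card_Diff_subset_Int[of "S `` {b}" heavy] finite_nbrs[of b] card_mono[of "S `` {b}" "S `` {b} \<inter> heavy"] by simp

text \<open>A heavy vertex has too many neighbours for all of them to be heavy. A light neighbour
  has only heavy neighbours, so its degree is at most \<open>card heavy\<close>, and Ore's condition
  leaves the rest to \<open>b\<close>.\<close>

lemma deg_heavy_ge:
  assumes small: "2 * card heavy \<le> card V" and b: "b \<in> heavy"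
  shows "card V \<le> deg b + card heavy"
proof -
  have "card (S `` {b} \<inter> heavy) < deg b"
    using card_nbrs_in_heavy[OF b] small b by (auto simp: heavy_def)
  then have "\<not> S `` {b} \<subseteq> heavy"
    by (metis Int_absorb2 less_irrefl)
  then obtain c where c: "(b, c) \<in> S" "c \<notin> heavy" by auto
  then have "deg c \<le> card heavy"
    using SV by (intro card_mono finite_heavy nbrs_of_light) auto
  then show ?thesis using ore[OF c(1)] by simp
qed

lemma sum_deg_light: "(\<Sum>c\<in>V - heavy. deg c) = (\<Sum>b\<in>heavy. card (S `` {b} - heavy))"
proof -
  have "(\<Sum>c\<in>V - heavy. deg c) = (\<Sum>c\<in>V - heavy. card (S `` {c} \<inter> heavy))"
    using nbrs_of_light by (intro sum.cong) (auto simp: Int_absorb2)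
  also have "\<dots> = (\<Sum>b\<in>heavy. card (S `` {b} \<inter> (V - heavy)))"
    using fin finite_heavy by (intro sum_card_neighbours_swap symS) auto
  also have "\<dots> = (\<Sum>b\<in>heavy. card (S `` {b} - heavy))"
    using SV by (intro sum.cong arg_cong[where f = card]) auto
  finally show ?thesis .
qed

lemma sum_deg_V: "(\<Sum>v\<in>V. deg v) = (\<Sum>b\<in>heavy. deg b + card (S `` {b} - heavy))"
  using sum.subset_diff[OF heavy_subset fin, of deg] by (simp add: sum_deg_light sum.distrib)

lemma heavy_le_half: "2 * card heavy \<le> card V"
proof (rule ccontr)
  let ?k = "card heavy" and ?n = "card V"
  assume "\<not> ?thesis"
  then have k: "?n + 1 \<le> 2 * ?k" by simp
  have "real ?k * ?n = (\<Sum>b\<in>heavy. real ?n)" by simp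
  also have "\<dots> \<le> (\<Sum>b\<in>heavy. 2 * real (deg b))"
    by (intro sum_mono) (auto simp: heavy_def simp flip: of_nat_mult)
  also have "\<dots> = 2 * (\<Sum>b\<in>heavy. real (deg b))"
    by (simp add: sum_distrib_left)
  also have "\<dots> \<le> 2 * (\<Sum>v\<in>V. real (deg v))"
    using sum_mono2[OF fin heavy_subset, of "\<lambda>v. real (deg v)"] by simp
  also have "\<dots> \<le> 4 * \<mu>\<^sup>2" using sum_deg_le by simp
  finally have le: "2 * real ?k * ?n \<le> 27 * real ?n - 45" using \<mu>_sq_le by linarith
  show False
  \<comment> \<open>For n = 24 the inequality 25 \<le> 2k is consistent with \<open>le\<close> over
    the reals; integrality raises it to k \<ge> 13.\<close>
  proof (cases "?n = 24")
    case True
    with k have "real ?k \<ge> 13" by simp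
    with le show False unfolding True by simp
  next
    case False
    then have n: "real ?n \<ge> 25" using large by simp
    have "(real ?n + 1) * ?n \<le> 2 * real ?k * ?n"
      using k by (intro mult_right_mono) linarith+
    moreover have "(real ?n - 25) * (real ?n - 1) \<ge> 0" using n by simp
    ultimately show False using le by (simp add: algebra_simps)
  qed
qed

lemma heavy_le_four: "card heavy \<le> 4"
proof (rule ccontr)
  define k n where "k = real (card heavy)" and "n = real (card V)"
  assume "\<not> ?thesis"
  then have k5: "k \<ge> 5" by (simp add: k_def)
  have k2: "2 * k \<le> n" using heavy_le_half by (simp add: k_def n_def)
  have n: "n \<ge> 24" using large by (simp add: n_def)
  \<comment> \<open>\<open>b\<close> has at least n-k neighbours, at most k-1 of them heavy. The
    remaining n-2k+1 or more count twice, the second time through the degrees of the light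
    vertices.\<close>
  have "2 * n - 3 * k + 1 \<le> real (deg b + card (S `` {b} - heavy))" if "b \<in> heavy" for b
    using deg_heavy_ge[OF heavy_le_half that] card_nbrs_in_heavy[OF that] deg_split[of b]
    unfolding k_def n_def by linarith
  then have "(\<Sum>b\<in>heavy. 2 * n - 3 * k + 1) \<le> (\<Sum>b\<in>heavy. real (deg b + card (S `` {b} - heavy)))"
    by (rule sum_mono)
  also have "\<dots> = (\<Sum>v\<in>V. real (deg v))"
    unfolding of_nat_sum[symmetric] sum_deg_V ..
  also have "4 * \<dots> \<le> 8 * \<mu>\<^sup>2" using sum_deg_le by simp
  finally have le: "4 * (k * (2 * n - 3 * k + 1)) \<le> 27 * n - 45"
    using \<mu>_sq_le by (simp add: k_def n_def)
  \<comment> \<open>The left side of \<open>le\<close> is concave in k, so on the interval from 5 to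
    n/2 it lies above its chord, which is the next estimate.\<close>
  have "(k - 5) * (n - 2 * k) \<ge> 0" using k5 k2 by simp
  then have "4 * (k * (2 * n - 3 * k + 1)) \<ge> 2 * (k * (n - 28)) + 30 * n"
    by (simp add: algebra_simps)
  with le have upper: "2 * (k * (n - 28)) \<le> - 3 * n - 45" by linarith
  show False
  proof (cases "n \<ge> 28")
    case True
    then have "0 \<le> k * (n - 28)" using k5 by simp
    with upper n show False by linarith
  next
    case False
    \<comment> \<open>Now the coefficient of k is negative, so k = n/2 is the extreme case.\<close>
    then have "n / 2 * (n - 28) \<le> k * (n - 28)" using k2 by (intro mult_right_mono_neg) auto
    with upper have "n * (n - 28) \<le> - 3 * n - 45" by linarith
    moreover have "(n - 24) * (n - 1) \<ge> 0" using n by simp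
    ultimately show False by (simp add: algebra_simps)
  qed
qed

text \<open>The Rayleigh quotient of the vector that is 1 on the heavy vertices and \<open>t = 2 / sqrt (n - 4)\<close>
  elsewhere; as \<open>t \<le> 1/2\<close>, edges inside the heavy set only help.\<close>

lemma card_heavy_le: "card heavy \<le> 3"
proof (rule ccontr)
  assume "\<not> ?thesis"
  \<comment> \<open>For four heavy vertices the degree count reads 32n - 176 \<le> 27n - 45, which
    is consistent up to n = 26; a sharper test vector is required.\<close>
  with heavy_le_four have k: "card heavy = 4" by simp
  define n where "n = real (card V)"
  have n: "n \<ge> 24" using large by (simp add: n_def)
  \<comment> \<open>The vector is the Perron vector of the complete bipartite graph with parts 4 and
    n-4, with eigenvalue \<open>2 * w\<close>; both parts have squared norm 4.\<close>
  define w where "w = sqrt (n - 4)"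
  define t where "t = 2 / w"
  have w: "w\<^sup>2 = n - 4" "w \<ge> 4"
    using n real_le_rsqrt[of 4 "n - 4"] by (simp_all add: w_def)
  have t: "0 \<le> t" "t \<le> 1 / 2" "t * w = 2"
    using w by (simp_all add: t_def field_simps)
  define x where "x v = (if v \<in> heavy then 1 else t)" for v
  have nb: "nbr_sum S x u = card (S `` {u} \<inter> heavy) + card (S `` {u} - heavy) * t" for u
    unfolding x_def by (simp add: nbr_sum_two_valued[OF SV fin heavy_subset])
  have split: "(\<Sum>u\<in>V. f u) = (\<Sum>u\<in>heavy. f u) + (\<Sum>u\<in>V - heavy. f u)" for f :: "'a \<Rightarrow> real"
    using sum.subset_diff[OF heavy_subset fin, of f] by simp
  have light: "(\<Sum>u\<in>V - heavy. x u * nbr_sum S x u) = (\<Sum>b\<in>heavy. card (S `` {b} - heavy) * t)"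
  proof -
    have "x u * nbr_sum S x u = t * deg u" if u: "u \<in> V - heavy" for u
    proof -
      have "S `` {u} - heavy = {}" "S `` {u} \<inter> heavy = S `` {u}"
        using nbrs_of_light[OF u] by blast+
      then show ?thesis using u unfolding nb x_def by (simp only: card.empty) simp
    qed
    then have "(\<Sum>u\<in>V - heavy. x u * nbr_sum S x u) = t * real (\<Sum>u\<in>V - heavy. deg u)"
      by (simp add: sum_distrib_left)
    then show ?thesis by (simp add: sum_deg_light sum_distrib_left mult.commute)
  qed
  \<comment> \<open>Edges to light vertices carry \<open>2 * t\<close> because they are seen from
    both ends.\<close>
  have "2 * t * (n - 4) \<le> real (card (S `` {b} \<inter> heavy)) + 2 * t * card (S `` {b} - heavy)" if b: "b \<in> heavy" for b
  proof -
    let ?i = "real (card (S `` {b} \<inter> heavy))" and ?o = "real (card (S `` {b} - heavy))"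
    have "n - 4 \<le> ?i + ?o"
      using deg_heavy_ge[OF heavy_le_half b] deg_split[of b] unfolding n_def k by linarith
    then have "2 * t * (n - 4) \<le> 2 * t * (?i + ?o)" using t by (intro mult_left_mono) auto
    moreover have "2 * t * ?i \<le> 1 * ?i" using t by (intro mult_right_mono) auto
    ultimately show ?thesis by (simp add: algebra_simps)
  qed
  then have "(\<Sum>b\<in>heavy. 2 * t * (n - 4))
      \<le> (\<Sum>b\<in>heavy. real (card (S `` {b} \<inter> heavy)) + 2 * t * card (S `` {b} - heavy))"
    by (rule sum_mono)
  also have "\<dots> = (\<Sum>u\<in>heavy. x u * nbr_sum S x u) + (\<Sum>b\<in>heavy. card (S `` {b} - heavy) * t)"
    unfolding sum.distrib[symmetric] by (intro sum.cong) (simp_all add: nb x_def)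
  also have "\<dots> = (\<Sum>u\<in>V. x u * nbr_sum S x u)"
    unfolding split light ..
  also have "\<dots> \<le> \<mu> * (\<Sum>u\<in>V. (x u)\<^sup>2)"
    using t by (intro rayleigh_le) (simp add: x_def)
  also have "(\<Sum>u\<in>V. (x u)\<^sup>2) = 4 + (n - 4) * t\<^sup>2"
  proof -
    have "card (V - heavy) = card V - 4"
      using card_Diff_subset[OF finite_heavy heavy_subset] k by simp
    then show ?thesis
      unfolding split using k large by (simp add: x_def n_def of_nat_diff)
  qed
  also have "(n - 4) * t\<^sup>2 = 4"
    using t(3) unfolding w(1)[symmetric] power_mult_distrib[symmetric] by (simp add: mult.commute)
  finally have "t * (n - 4) \<le> \<mu>" using k by simp
  moreover have "t * (n - 4) = 2 * w"
    using t(3) unfolding w(1)[symmetric] by (simp add: power2_eq_square mult.assoc[symmetric])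
  ultimately have "(2 * w)\<^sup>2 \<le> \<mu>\<^sup>2"
    using w by (intro power_mono) auto
  then have "4 * (n - 4) \<le> \<mu>\<^sup>2" by (simp add: power_mult_distrib w(1))
  then show False using \<mu>_sq_le n by (simp add: n_def)
qed

end

section \<open>The graph \<open>N\<^bsub>n-3,3\<^esub>\<close>\<close>

text \<open>A copy of the extremal graph on an arbitrary vertex set: \<open>V - B\<close> is the
  clique, and each \<open>b\<close> in \<open>B\<close> hangs on \<open>g b\<close>. It can thus be
  compared with \<open>E\<close> arc by arc before any isomorphism is built.\<close>

definition net_rel :: "'a set \<Rightarrow> 'a set \<Rightarrow> ('a \<Rightarrow> 'a) \<Rightarrow> 'a rel" where
  "net_rel V B g = {(u, v). u \<in> V \<and> v \<in> V \<and> u \<noteq> v \<and>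
     (u \<notin> B \<and> v \<notin> B \<or> u \<in> B \<and> v = g u \<or> v \<in> B \<and> u = g v)}"

text \<open>The Perron vector of the complement, for the largest root \<open>l\<close> of \<open>l\<^sup>2 = 2 l + 3 n - 14\<close>.\<close>

definition net_vec :: "'a set \<Rightarrow> ('a \<Rightarrow> 'a) \<Rightarrow> real \<Rightarrow> 'a \<Rightarrow> real" where
  "net_vec B g l v = (if v \<in> B then l else if v \<in> g ` B then 2 else 3)"

text \<open>In the complement the clique is independent: a vertex of it sees two or three pendant
  vertices, which explains the values 2 and 3. A pendant vertex sees two pendants, two bases and the
  n-6 others, so its equation is l * l = 2l + 4 + 3(n-6), the quadratic for l.\<close>

lemma nbr_sum_net_vec:
  assumes fin: "finite V" and B: "B \<subseteq> V" "card B = 3" and g: "inj_on g B" "g ` B \<subseteq> V - B"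
    and l: "l\<^sup>2 = 2 * l + 3 * real (card V) - 14" and u: "u \<in> V"
  shows "nbr_sum (non_edges V (net_rel V B g)) (net_vec B g l) u = l * net_vec B g l u"
proof -
  let ?S = "non_edges V (net_rel V B g)" and ?x = "net_vec B g l"
  define W where "W = V - B - g ` B"
  have finB: "finite B" using fin B finite_subset by blast
  have cg: "card (g ` B) = 3" using g(1) B by (simp add: card_image)
  have "card (B \<union> g ` B) = 6"
    using g B cg finB by (subst card_Un_disjoint) auto
  moreover have "B \<union> g ` B \<subseteq> V" "W = V - (B \<union> g ` B)"
    using B g by (auto simp: W_def)
  ultimately have cW: "card V = card W + 6"
    using card_Diff_subset[of "B \<union> g ` B" V] card_mono[OF fin, of "B \<union> g ` B"] finB by simp
  have sumB: "(\<Sum>v\<in>B - {b}. ?x v) = 2 * l" if "b \<in> B" for b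
    using that B finB by (simp add: net_vec_def)
  consider (pendant) "u \<in> B" | (base) b where "b \<in> B" "u = g b" | (rest) "u \<in> W"
    using u by (auto simp: W_def)
  then show ?thesis
  proof cases
    case pendant
    have gu: "g u \<in> g ` B" using pendant by simp
    have "?S `` {u} = (B - {u}) \<union> ((g ` B - {g u}) \<union> W)"
      using pendant B g u by (auto simp: non_edges_def net_rel_def W_def)
    moreover have "(B - {u}) \<inter> ((g ` B - {g u}) \<union> W) = {}" "(g ` B - {g u}) \<inter> W = {}"
      using g by (auto simp: W_def)
    moreover have "finite W" using fin by (simp add: W_def)
    ultimately have "nbr_sum ?S ?x u
        = (\<Sum>v\<in>B - {u}. ?x v) + ((\<Sum>v\<in>g ` B - {g u}. ?x v) + (\<Sum>v\<in>W. ?x v))"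
      using finB by (simp add: nbr_sum_def sum.union_disjoint)
    also have "(\<Sum>v\<in>g ` B - {g u}. ?x v) = (\<Sum>v\<in>g ` B - {g u}. 2)"
      using g by (intro sum.cong) (auto simp: net_vec_def)
    also have "\<dots> = 4" using gu cg finB by simp
    also have "(\<Sum>v\<in>W. ?x v) = (\<Sum>v\<in>W. 3)"
      by (intro sum.cong) (auto simp: net_vec_def W_def)
    also have "(\<Sum>v\<in>B - {u}. ?x v) + (4 + (\<Sum>v\<in>W. 3)) = l\<^sup>2"
      unfolding sumB[OF pendant] l cW by simp
    finally have "nbr_sum ?S ?x u = l\<^sup>2" .
    moreover have "?x u = l" using pendant by (simp add: net_vec_def)
    ultimately show ?thesis by (simp add: power2_eq_square)
  next
    case base
    have "?S `` {u} = B - {b}"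
      using base B g u by (auto simp: non_edges_def net_rel_def inj_on_def)
    then show ?thesis using base g sumB[OF base(1)] by (auto simp: nbr_sum_def net_vec_def)
  next
    case rest
    have "?S `` {u} = B"
      using rest B g u by (auto simp: non_edges_def net_rel_def W_def)
    moreover have "(\<Sum>v\<in>B. ?x v) = (\<Sum>v\<in>B. l)"
      by (intro sum.cong) (simp_all add: net_vec_def)
    ultimately show ?thesis using rest B by (simp add: nbr_sum_def net_vec_def W_def)
  qed
qed

lemma parcs_graph_complement: "parcs (graph_complement G) = non_edges (pverts G) (parcs G)"
  and pverts_graph_complement: "pverts (graph_complement G) = pverts G"
  by (simp_all add: graph_complement_def non_edges_def)

lemma parcs_N_graph:
  "parcs (N_graph m k) = net_rel {0..<m + k} {m..<m + k} (\<lambda>b. b - m)" if "k \<le> m"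
  using that by (auto simp: N_graph_def net_rel_def)

lemma spectral_radius_complement_N_graph_le:
  assumes n: "n \<ge> 6" and l: "l > 0" "l\<^sup>2 = 2 * l + 3 * real n - 14"
  shows "graph_spectral_radius (graph_complement (N_graph (n - 3) 3)) \<le> l"
proof (rule spectral_radius_le_positive_vector)
  let ?N = "N_graph (n - 3) 3" and ?g = "\<lambda>b. b - (n - 3)"
  have V: "pverts (graph_complement ?N) = {0..<n}"
    using n by (simp add: pverts_graph_complement N_graph_def)
  show "pair_graph (graph_complement ?N)"
    using n by (intro pair_graph_complement pair_graph_N_graph) simp
  show "pverts (graph_complement ?N) \<noteq> {}"
    using n by (simp add: V)
  fix u assume u: "u \<in> pverts (graph_complement ?N)"
  show "net_vec {n - 3..<n} ?g l u > 0"
    using l by (simp add: net_vec_def)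
  have arcs: "parcs (graph_complement ?N) = non_edges {0..<n} (net_rel {0..<n} {n - 3..<n} ?g)"
    using n parcs_N_graph[of 3 "n - 3"] by (simp add: parcs_graph_complement) (simp add: N_graph_def)
  show "nbr_sum (parcs (graph_complement ?N)) (net_vec {n - 3..<n} ?g l) u \<le> l * net_vec {n - 3..<n} ?g l u"
    unfolding arcs
  proof (rule eq_refl, rule nbr_sum_net_vec)
    show "inj_on ?g {n - 3..<n}" by (rule inj_onI) (metis atLeastLessThan_iff eq_diff_iff)
    show "?g ` {n - 3..<n} \<subseteq> {0..<n} - {n - 3..<n}"
    proof
      fix a assume "a \<in> ?g ` {n - 3..<n}"
      then have "a < 3" by auto
      with n show "a \<in> {0..<n} - {n - 3..<n}" by auto
    qed
  qed (use n l u V in auto)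
qed

lemma net_rel_image:
  assumes f: "inj_on f V" "f ` V = V'" "f ` B = B'" and B: "B \<subseteq> V" "g ` B \<subseteq> V"
    and g: "\<And>b. b \<in> B \<Longrightarrow> f (g b) = g' (f b)"
  shows "map_prod f f ` net_rel V B g = net_rel V' B' g'"
proof -
  have inB: "f v \<in> B' \<longleftrightarrow> v \<in> B" if "v \<in> V" for v
    using that f B by (auto dest: inj_onD)
  have eq: "f u = f v \<longleftrightarrow> u = v" if "u \<in> V" "v \<in> V" for u v
    using f(1) that by (auto dest: inj_onD)
  have geq: "f v = g' (f u) \<longleftrightarrow> v = g u" if "u \<in> B" "v \<in> V" for u v
    using g[OF that(1)] eq[of v "g u"] that B by auto
  have iff: "(f u, f v) \<in> net_rel V' B' g' \<longleftrightarrow> (u, v) \<in> net_rel V B g" if "u \<in> V" "v \<in> V" for u v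
    using that f(2) inB eq geq unfolding net_rel_def by blast
  show ?thesis
  proof (intro subset_antisym subsetI)
    fix e assume "e \<in> map_prod f f ` net_rel V B g"
    then obtain u v where "e = (f u, f v)" "(u, v) \<in> net_rel V B g" by auto
    then show "e \<in> net_rel V' B' g'"
      using iff[of u v] by (auto simp: net_rel_def)
  next
    fix e assume e: "e \<in> net_rel V' B' g'"
    then have "fst e \<in> f ` V" "snd e \<in> f ` V"
      unfolding f(2) by (auto simp: net_rel_def)
    then obtain u v where "u \<in> V" "v \<in> V" "e = (f u, f v)"
      by (metis imageE prod.collapse)
    then show "e \<in> map_prod f f ` net_rel V B g"
      using iff[of u v] e by (auto intro!: image_eqI[of _ _ "(u, v)"])
  qed
qed

lemma digraph_iso_N_graph:
  assumes G: "pair_graph G" and V: "pverts G = V" "card V = n" and n: "n \<ge> 6"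
    and B: "B \<subseteq> V" "card B = 3" and g: "inj_on g B" "g ` B \<subseteq> V - B"
    and arcs: "parcs G = net_rel V B g"
  shows "digraph_iso (with_proj G) (with_proj (N_graph (n - 3) 3))"
proof -
  interpret pair_graph G by fact
  have fin: "finite V" using pair_finite_verts V by simp
  have finB: "finite B" using fin B finite_subset by blast
  define W where "W = V - B - g ` B"
  have cg: "card (g ` B) = 3" using g(1) B by (simp add: card_image)
  have "card (B \<union> g ` B) = 6"
    using g B cg finB by (subst card_Un_disjoint) auto
  moreover have "B \<union> g ` B \<subseteq> V" "W = V - (B \<union> g ` B)"
    using B g by (auto simp: W_def)
  ultimately have "card W = n - 6"
    using card_Diff_subset[of "B \<union> g ` B" V] finB V(2) by simp
  have "\<exists>h. bij_betw h B {n - 3..<n}"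
    by (rule finite_same_card_bij) (use finB B n in auto)
  then obtain h where h: "bij_betw h B {n - 3..<n}" by blast
  have "\<exists>k. bij_betw k W {3..<n - 3}"
    by (rule finite_same_card_bij) (use fin \<open>card W = n - 6\<close> n in \<open>auto simp: W_def\<close>)
  then obtain k where k: "bij_betw k W {3..<n - 3}" by blast
  \<comment> \<open>On the bases the bijection is forced: \<open>g b\<close> must go to the image of
    \<open>b\<close> lowered by \<open>n - 3\<close>, so that attachment is preserved.\<close>
  define h' where "h' = (\<lambda>v. h (the_inv_into B g v) - (n - 3))"
  have h'g: "h' (g b) = h b - (n - 3)" if "b \<in> B" for b
    using that g(1) by (simp add: h'_def the_inv_into_f_f)
  have h': "bij_betw h' (g ` B) {0..<3}"
  proof -
    have "bij_betw (\<lambda>i. i - (n - 3)) {n - 3..<n} {0..<3}"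
      using n by (intro bij_betwI[where g = "\<lambda>i. i + (n - 3)"]) auto
    then have "bij_betw ((\<lambda>i. i - (n - 3)) \<circ> (h \<circ> the_inv_into B g)) (g ` B) {0..<3}"
      using h bij_betw_the_inv_into[OF inj_on_imp_bij_betw[OF g(1)]] by (blast intro: bij_betw_trans)
    then show ?thesis by (simp add: h'_def o_def)
  qed
  define f where "f v = (if v \<in> B then h v else if v \<in> g ` B then h' v else k v)" for v
  have fB: "bij_betw f B {n - 3..<n}"
    using h by (rule bij_betw_cong[THEN iffD1, rotated]) (simp add: f_def)
  have fg: "bij_betw f (g ` B) {0..<3}"
    using h' by (rule bij_betw_cong[THEN iffD1, rotated]) (use g in \<open>auto simp: f_def\<close>)
  have fW: "bij_betw f W {3..<n - 3}"
    using k by (rule bij_betw_cong[THEN iffD1, rotated]) (simp add: f_def W_def)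
  have "bij_betw f (g ` B \<union> W \<union> B) ({0..<3} \<union> {3..<n - 3} \<union> {n - 3..<n})"
    using n by (intro bij_betw_combine fB fg fW) auto
  moreover have "g ` B \<union> W \<union> B = V" using B g by (auto simp: W_def)
  moreover have "{0..<3} \<union> {3..<n - 3} \<union> {n - 3..<n} = {0..<n}" using n by auto
  ultimately have f: "bij_betw f V {0..<n}" by simp
  have image: "map_prod f f ` parcs G = parcs (N_graph (n - 3) 3)"
  proof -
    have "map_prod f f ` net_rel V B g = net_rel {0..<n} {n - 3..<n} (\<lambda>b. b - (n - 3))"
    proof (rule net_rel_image)
      fix b assume "b \<in> B"
      then show "f (g b) = f b - (n - 3)" using g(2) h'g by (auto simp: f_def)
    qed (use f fB B g in \<open>auto simp: bij_betw_def\<close>)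
    then show ?thesis using n parcs_N_graph[of 3 "n - 3"] by (simp add: arcs)
  qed
  define F where "F = \<lparr> iso_verts = f, iso_arcs = map_prod f f, iso_head = snd, iso_tail = fst \<rparr>"
  have "inj_on f V" using f by (rule bij_betw_imp_inj_on)
  moreover have "inj_on (map_prod f f) (parcs G)"
    using map_prod_inj_on[OF \<open>inj_on f V\<close> \<open>inj_on f V\<close>]
    by (rule inj_on_subset) (auto simp: arcs net_rel_def)
  ultimately have "pre_digraph.digraph_isomorphism (with_proj G) F"
    unfolding pre_digraph.digraph_isomorphism_def
    using V by (auto simp: F_def wf_digraph_wp_iff pair_wf_digraph)
  moreover have "with_proj (N_graph (n - 3) 3) = app_iso F (with_proj G)"
  proof -
    have "pverts (N_graph (n - 3) 3) = {0..<n}" using n by (simp add: N_graph_def)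
    moreover have "f ` V = {0..<n}" using f by (rule bij_betw_imp_surj_on)
    ultimately show ?thesis
      by (simp add: with_proj_def app_iso_def F_def V image)
  qed
  ultimately show ?thesis
    unfolding digraph_iso_def by blast
qed

section \<open>Traceability, claws and connectedness as properties of the arc relation\<close>

lemma successively_vwalk_arcs:
  "successively (\<lambda>u v. (u, v) \<in> R) p \<Longrightarrow> set (vwalk_arcs p) \<subseteq> R"
  by (induction p rule: vwalk_arcs.induct) auto

lemma traceable_if_hamilton_path:
  assumes "has_hamilton_path (pverts G) (parcs G)" "pverts G \<noteq> {}"
  shows "traceable G"
proof -
  obtain p where p: "distinct p" "set p = pverts G" "successively (\<lambda>u v. (u, v) \<in> parcs G) p"
    using assms(1) by (auto simp: has_hamilton_path_def)
  then have "vpath p (with_proj G)"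
    using assms(2) successively_vwalk_arcs[OF p(3)] by (auto simp: vpath_def vwalk_def)
  then show ?thesis using p by (auto simp: traceable_def)
qed

lemma claw_freeD:
  assumes G: "pair_graph G" and "claw_free G"
    and E: "(u, x) \<in> parcs G" "(u, y) \<in> parcs G" "(u, z) \<in> parcs G" and d: "distinct [x, y, z]"
  shows "(x, y) \<in> parcs G \<or> (x, z) \<in> parcs G \<or> (y, z) \<in> parcs G"
proof (rule ccontr)
  assume neg: "\<not> ?thesis"
  interpret pair_graph G by fact
  define W where "W = {u, x, y, z}"
  define H where "H = \<lparr> pverts = W, parcs = {e \<in> parcs G. fst e \<in> W \<and> snd e \<in> W} \<rparr>"
  have irr: "(v, v) \<notin> parcs G" for v
    using pair_no_loops by fastforce
  have neq: "u \<noteq> x" "u \<noteq> y" "u \<noteq> z"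
    using E irr by metis+
  have "(v, w) \<in> parcs H \<longleftrightarrow> (v, w) \<in> {u} \<times> {x, y, z} \<union> {x, y, z} \<times> {u}" for v w
  proof -
    have "(y, x) \<notin> parcs G" "(z, x) \<notin> parcs G" "(z, y) \<notin> parcs G"
      using neg arcs_symmetric by blast+
    moreover have "(x, u) \<in> parcs G" "(y, u) \<in> parcs G" "(z, u) \<in> parcs G"
      using E arcs_symmetric by blast+
    moreover have "(v, w) \<in> parcs H \<longleftrightarrow> v \<in> W \<and> w \<in> W \<and> (v, w) \<in> parcs G"
      by (auto simp: H_def)
    ultimately show ?thesis
      using E neg irr unfolding W_def by blast
  qed
  then have "parcs H = {u} \<times> {x, y, z} \<union> {x, y, z} \<times> {u}"
    by (simp only: set_eq_iff split_paired_All simp_thms)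
  moreover have "pverts H = {u} \<union> {x, y, z}" "{u} \<inter> {x, y, z} = {}" "card {x, y, z} = 3"
    using neq d by (auto simp: H_def W_def)
  moreover have "card {u} = 1" "finite (pverts H)"
    by (simp_all add: H_def W_def)
  ultimately have K: "complete_bipartite_digraph 1 3 (with_proj H)"
    unfolding complete_bipartite_digraph_pair_def by blast
  have "W \<subseteq> pverts G"
    using in_arcsD1[OF E(1)] in_arcsD2[OF E(1)] in_arcsD2[OF E(2)] in_arcsD2[OF E(3)] by (simp add: W_def)
  then have "induced_subgraph (with_proj H) (with_proj G)"
    unfolding induced_subgraph_def subgraph_def compatible_def wf_digraph_wp_iff
    using pair_graph.axioms(1)[OF pair_graphI_complete_bipartite[OF K], THEN pair_digraph.pair_wf_digraph]
      pair_wf_digraph by (auto simp: H_def)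
  with K assms(2) show False by (auto simp: claw_free_def)
qed

text \<open>The arcs are already symmetric, so connectedness is reachability along them; a set that
  no arc leaves would contain everything reachable from it.\<close>

lemma connected_cut_edge:
  assumes G: "pair_graph G" and conn: "Digraph_Component.connected (with_proj G)"
    and S: "S \<subset> pverts G" "S \<noteq> {}"
  shows "\<exists>u\<in>S. \<exists>v\<in>pverts G - S. (u, v) \<in> parcs G"
proof (rule ccontr)
  assume neg: "\<not> ?thesis"
  interpret pair_graph G by fact
  obtain a b where ab: "a \<in> S" "b \<in> pverts G" "b \<notin> S" using S by blast
  have "arcs_ends (with_proj (mk_symmetric (with_proj G))) = parcs G"
    using arcs_symmetric by (force simp: mk_symmetric_def)
  then have "(a, b) \<in> rtrancl_on (pverts G) (parcs G)"
    using conn ab S(1) unfolding Digraph_Component.connected_def strongly_connected_def reachable_def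
    by (auto simp: mk_symmetric_def)
  then have "b \<in> S"
    by (induction rule: rtrancl_on_induct) (use ab neg in auto)
  with ab show False by simp
qed

lemma nbr_sum_mono:
  assumes "S \<subseteq> T" "T \<subseteq> V \<times> V" "finite V" "\<And>v. x v \<ge> 0"
  shows "nbr_sum S x u \<le> nbr_sum T x u"
  unfolding nbr_sum_def using assms
  by (intro sum_mono2) (auto intro: finite_subset[of _ V])

lemma nbr_sum_nonneg: "(\<And>v. x v \<ge> 0) \<Longrightarrow> nbr_sum S x u \<ge> 0"
  by (simp add: nbr_sum_def sum_nonneg)

theorem theorem6:
  fixes G :: "'a pair_pre_digraph" and n :: nat
  assumes "pair_graph G"
    and "Digraph_Component.connected (with_proj G)"
    and "claw_free G"
    and "card (pverts G) = n"
    and "n \<ge> 24"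
    and "graph_spectral_radius (graph_complement G)
           \<le> graph_spectral_radius (graph_complement (N_graph (n - 3) 3))"
  shows "traceable G \<or> digraph_iso (with_proj G) (with_proj (N_graph (n - 3) 3))"
proof (rule disj_imp[THEN iffD2], rule impI)
  assume nontraceable: "\<not> traceable G"
  interpret pair_graph G by fact
  define V E where "V = pverts G" and "E = parcs G"
  define H where "H = graph_complement G"
  define \<mu> where "\<mu> = graph_spectral_radius H"
  define l where "l = 1 + sqrt (3 * real n - 13)"
  have fin: "finite V" and ne: "V \<noteq> {}" and cardV: "card V = n"
    using pair_finite_verts assms(4,5) by (auto simp: V_def)
  have EV: "E \<subseteq> V \<times> V" and symE: "sym E"
    using in_arcsD1 in_arcsD2 arcs_symmetric by (auto simp: E_def V_def sym_def)
  have irrE: "irrefl E"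
    unfolding irrefl_def E_def using no_loops' by blast
  have H: "pair_graph H" "pverts H = V" "parcs H = non_edges V E"
    using pair_graph_complement[OF assms(1)]
    by (simp_all add: H_def V_def E_def pverts_graph_complement parcs_graph_complement)
  have HV: "parcs H \<subseteq> V \<times> V" by (auto simp: H non_edges_def)
  have Hne: "pverts H \<noteq> {}" using ne H by simp
  have l: "l > 0" "l\<^sup>2 = 2 * l + 3 * real n - 14"
    using assms(5) by (simp_all add: l_def power2_eq_square algebra_simps add_pos_nonneg)
  \<comment> \<open>The hypothesis on the two spectral radii enters only through this explicit
    bound.\<close>
  have \<mu>: "\<mu> \<ge> 0" "\<mu> \<le> l"
    using spectral_radius_ge_nbr_sum_norm(2)[OF H(1) Hne] assms(5,6)
      spectral_radius_complement_N_graph_le[OF _ l] by (simp_all add: \<mu>_def H_def)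
  have "\<not> has_hamilton_path V E"
    using nontraceable traceable_if_hamilton_path ne by (auto simp: V_def E_def)
  from maximal_without_hamilton_path[OF fin EV symE irrE this]
  obtain R where R: "E \<subseteq> R" "R \<subseteq> V \<times> V" "sym R" "irrefl R" "\<not> has_hamilton_path V R"
    and max: "\<And>u v. (u, v) \<in> non_edges V R \<Longrightarrow> has_hamilton_path V (R \<union> {(u, v), (v, u)})"
    by blast
  let ?S = "non_edges V R"
  have SH: "?S \<subseteq> parcs H" using R(1) by (auto simp: H non_edges_def)
  \<comment> \<open>Ore's condition comes from maximality of \<open>R\<close>; the spectral bounds
    come from the larger relation \<open>parcs H\<close> by monotonicity on nonnegative
    vectors.\<close>
  interpret C: ore_graph V ?S \<mu>
  proof
    show "sym ?S" "irrefl ?S" "?S \<subseteq> V \<times> V"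
      using R(3) by (auto simp: sym_def irrefl_def non_edges_def)
    show "card V \<le> card (?S `` {u}) + card (?S `` {v})" if "(u, v) \<in> ?S" for u v
      using that max by (intro non_edges_degree_sum fin R) auto
    fix x :: "'a \<Rightarrow> real" assume x: "\<And>v. x v \<ge> 0"
    have mono: "nbr_sum ?S x u \<le> nbr_sum (parcs H) x u" for u
      using nbr_sum_mono[OF SH HV fin x] .
    have "(\<Sum>u\<in>V. (nbr_sum ?S x u)\<^sup>2) \<le> (\<Sum>u\<in>V. (nbr_sum (parcs H) x u)\<^sup>2)"
      by (intro sum_mono power_mono mono nbr_sum_nonneg x)
    then show "(\<Sum>u\<in>V. (nbr_sum ?S x u)\<^sup>2) \<le> \<mu>\<^sup>2 * (\<Sum>u\<in>V. (x u)\<^sup>2)"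
      using spectral_radius_ge_nbr_sum_norm(1)[OF H(1) Hne, of x] by (simp add: \<mu>_def H)
    have "(\<Sum>u\<in>V. x u * nbr_sum ?S x u) \<le> (\<Sum>u\<in>V. x u * nbr_sum (parcs H) x u)"
      by (intro sum_mono mult_left_mono mono x)
    then show "(\<Sum>u\<in>V. x u * nbr_sum ?S x u) \<le> \<mu> * (\<Sum>u\<in>V. (x u)\<^sup>2)"
      using spectral_radius_ge_rayleigh[OF H(1) Hne, of x] by (simp add: \<mu>_def H)
  qed (use fin \<mu> assms(5) in \<open>simp_all add: l_def cardV\<close>)
  \<comment> \<open>The heavy set is padded to exactly three vertices; what remains consists of
    light vertices and is still a clique of \<open>R\<close>.\<close>
  obtain B where B: "C.heavy \<subseteq> B" "B \<subseteq> V" "card B = 3"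
    using exists_subset_between[OF C.card_heavy_le _ C.heavy_subset fin] assms(5) cardV by auto
  interpret D: clique_plus_three V E R "V - B"
  proof
    have "finite B" using B(2) fin finite_subset by blast
    then show "card (V - B) \<ge> 4"
      using card_Diff_subset[of B V] B assms(5) cardV by simp
    show "(u, v) \<in> R" if "u \<in> V - B" "v \<in> V - B" "u \<noteq> v" for u v
      using C.light_independent[of u v] that B by (auto simp: non_edges_def)
    show "\<exists>u\<in>W. \<exists>v\<in>V - W. (u, v) \<in> E" if "W \<subset> V" "W \<noteq> {}" for W
      using connected_cut_edge[OF assms(1,2)] that by (simp add: V_def E_def)
    show "(x, y) \<in> E \<or> (x, z) \<in> E \<or> (y, z) \<in> E"
      if "(u, x) \<in> E" "(u, y) \<in> E" "(u, z) \<in> E" "distinct [x, y, z]" for u x y z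
      using claw_freeD[OF assms(1,3)] that unfolding E_def by blast
  qed (use fin R EV symE irrE in auto)
  obtain b1 b2 b3 where b: "B = {b1, b2, b3}" "distinct [b1, b2, b3]"
    using B(3) by (auto simp: card_3_iff)
  have "D.split_off b1 b2 b3"
    using b B(2) unfolding D.split_off_def by auto
  then obtain g where g: "inj_on g B" "g ` B \<subseteq> V - B" "\<And>b v. b \<in> B \<Longrightarrow> (b, v) \<in> E \<longleftrightarrow> v = g b"
    using D.three_pendant_vertices[OF _ b(1)] by metis
  have E_net: "E \<subseteq> net_rel V B g"
  proof (rule subrelI)
    fix u v assume uv: "(u, v) \<in> E"
    then have "u \<in> V" "v \<in> V" "u \<noteq> v" "(v, u) \<in> E"
      using EV D.E_neq D.E_sym by auto
    with uv g(3) show "(u, v) \<in> net_rel V B g" by (auto simp: net_rel_def)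
  qed
  moreover have "net_rel V B g \<subseteq> E"
  proof (rule ccontr)
    assume "\<not> ?thesis"
    then obtain a c where ac: "(a, c) \<in> net_rel V B g" "(a, c) \<notin> E" by auto
    \<comment> \<open>The arcs of \<open>?N\<close> give the positive vector \<open>?x\<close>
      Rayleigh quotient exactly \<open>l\<close>. An additional arc (a, c) strictly increases the
      entry at \<open>a\<close> and decreases no other, so the quotient for \<open>H\<close> would
      exceed \<open>l\<close>, although it is at most \<mu> \<le> l.\<close>
    let ?N = "non_edges V (net_rel V B g)" and ?x = "net_vec B g l"
    have x: "?x v > 0" for v using l by (simp add: net_vec_def)
    have NH: "insert (a, c) ?N \<subseteq> parcs H"
      using E_net ac by (auto simp: H non_edges_def net_rel_def)
    have mono: "nbr_sum ?N ?x u \<le> nbr_sum (parcs H) ?x u" for u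
      using NH x by (intro nbr_sum_mono[OF _ HV fin]) (auto intro: less_imp_le)
    have a: "a \<in> V" "(a, c) \<notin> ?N" using ac by (auto simp: net_rel_def non_edges_def)
    have insert: "nbr_sum (insert (a, c) ?N) ?x a = ?x c + nbr_sum ?N ?x a"
    proof -
      have "insert (a, c) ?N `` {a} = insert c (?N `` {a})" by auto
      moreover have "finite (?N `` {a})" using fin by (auto simp: non_edges_def intro: finite_subset)
      ultimately show ?thesis using a by (simp add: nbr_sum_def)
    qed
    have "nbr_sum (insert (a, c) ?N) ?x a \<le> nbr_sum (parcs H) ?x a"
      using NH x by (intro nbr_sum_mono[OF _ HV fin]) (auto intro: less_imp_le)
    then have "nbr_sum ?N ?x a < nbr_sum (parcs H) ?x a"
      using insert x[of c] by linarith
    then have "(\<Sum>u\<in>V. ?x u * nbr_sum ?N ?x u) < (\<Sum>u\<in>V. ?x u * nbr_sum (parcs H) ?x u)"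
      using x mono a by (intro sum_strict_mono_ex1 fin) (auto intro!: mult_left_mono less_imp_le)
    also have "\<dots> \<le> \<mu> * (\<Sum>u\<in>V. (?x u)\<^sup>2)"
      using spectral_radius_ge_rayleigh[OF H(1) Hne, of ?x] by (simp add: \<mu>_def H)
    also have "\<dots> \<le> l * (\<Sum>u\<in>V. (?x u)\<^sup>2)"
      using \<mu> by (intro mult_right_mono sum_nonneg) auto
    also have "\<dots> = (\<Sum>u\<in>V. ?x u * nbr_sum ?N ?x u)"
      using nbr_sum_net_vec[OF fin B(2,3) g(1,2)] l(2) cardV
      by (simp add: sum_distrib_left power2_eq_square mult.left_commute)
    finally show False by simp
  qed
  ultimately have "parcs G = net_rel V B g" by (simp add: E_def)
  then show "digraph_iso (with_proj G) (with_proj (N_graph (n - 3) 3))"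
    using digraph_iso_N_graph[OF assms(1) V_def[symmetric] cardV _ B(2,3) g(1,2)] assms(5) by simp
qed

end
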